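(* Let $d\ge 2$ be an integer, $1\le p<\infty$, and $r=(r_1,\dots,r_d)\in\mathbb{Q}^d$. Let $s_p$ be a real number such that $s_p>\frac{d}{2(d+1)}$ if $1\le p\le \frac{2(d+1)}{d}$, and $s_p>\frac d2-\frac dp$ if $p\ge \frac{2(d+1)}{d}$. Then there is a constant $C$ (depending on $d,p,s_p,r$ but not on $N$) such that for every integer $N\ge1$, $$\Big\|\sup_{0<t<1}\Big|\prod_{j=1}^{d}\sum_{n_j=1}^{N}e^{2\pi i(n_j(x_j-r_jt)+n_j^2t)}\Big|\Big\|_{L^{p}(\mathbb{T}^{d},\,dx)}\le C\,N^{\frac d2+s_p}.$$
   Context: $\mathbb{T}^d=\mathbb{R}^d/\mathbb{Z}^d$ with Lebesgue measure, $x=(x_1,\dots,x_d)$. *)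

theory Defs
  imports "HOL-Analysis.Analysis"
begin

text \<open>A dimension is encoded as a finite index type \<open>'d\<close>, so \<open>d = CARD('d)\<close>.  The torus is
  represented by its fundamental domain \<open>[0,1)\<^sup>d\<close> with Lebesgue measure; functions on the torus are
  functions on \<open>\<real>\<^sup>d\<close> invariant under integer translations.\<close>

definition torus_measure :: "(real ^ 'd) measure" where
  "torus_measure = lebesgue_on {x. \<forall>j. 0 \<le> x $ j \<and> x $ j < 1}"

text \<open>Meaningful only if \<open>\<bar>f\<bar>\<close> to the power \<open>p\<close> is integrable, since the Bochner integral is 0
  otherwise; see \<open>integrable_weyl_maximal\<close> below.\<close>

definition Lp_norm :: "real \<Rightarrow> 'a measure \<Rightarrow> ('a \<Rightarrow> real) \<Rightarrow> real" where
  "Lp_norm p M f = (LINT x|M. \<bar>f x\<bar> powr p) powr (1 / p)"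

definition weyl_product :: "real ^ 'd \<Rightarrow> nat \<Rightarrow> real \<Rightarrow> real ^ 'd \<Rightarrow> complex" where
  "weyl_product r N t x =
     (\<Prod>j\<in>UNIV. \<Sum>n=1..N. exp (2 * of_real pi * \<i> *
        of_real (real n * (x $ j - r $ j * t) + (real n)\<^sup>2 * t)))"

definition weyl_maximal :: "real ^ 'd \<Rightarrow> nat \<Rightarrow> real ^ 'd \<Rightarrow> real" where
  "weyl_maximal r N x = (SUP t\<in>{0<..<1}. norm (weyl_product r N t x))"

lemma norm_weyl_product_le: "norm (weyl_product r N t (x :: real ^ 'd)) \<le> real N ^ CARD('d)"
proof -
  have "norm (\<Sum>n=1..N. exp (2 * of_real pi * \<i> *
        of_real (real n * (x $ j - r $ j * t) + (real n)\<^sup>2 * t))) \<le> real N" for j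
    by (rule order_trans[OF norm_sum]) (simp add: norm_exp_eq_Re)
  then have "(\<Prod>j\<in>(UNIV :: 'd set). norm (\<Sum>n=1..N. exp (2 * of_real pi * \<i> *
        of_real (real n * (x $ j - r $ j * t) + (real n)\<^sup>2 * t)))) \<le> (\<Prod>j\<in>(UNIV :: 'd set). real N)"
    by (intro prod_mono) simp
  then show ?thesis
    by (simp add: weyl_product_def prod_norm)
qed

lemma bdd_above_weyl_product: "bdd_above ((\<lambda>t. norm (weyl_product r N t x)) ` S)"
  by (rule bdd_aboveI2[OF norm_weyl_product_le])

lemma weyl_maximal_bounds:
  fixes x :: "real ^ 'd"
  shows "0 \<le> weyl_maximal r N x" "weyl_maximal r N x \<le> real N ^ CARD('d)"
proof -
  show "weyl_maximal r N x \<le> real N ^ CARD('d)"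
    unfolding weyl_maximal_def by (rule cSUP_least) (auto simp: norm_weyl_product_le)
  have "norm (weyl_product r N (1/2) x) \<le> weyl_maximal r N x"
    unfolding weyl_maximal_def by (rule cSUP_upper[OF _ bdd_above_weyl_product]) simp
  then show "0 \<le> weyl_maximal r N x"
    using norm_ge_zero order_trans by blast
qed

lemma weyl_product_periodic:
  assumes "\<And>j. k $ j \<in> \<int>"
  shows "weyl_product r N t (x + k) = weyl_product r N t x"
proof -
  have "exp (2 * of_real pi * \<i> * of_real (real n * ((x + k) $ j - r $ j * t) + (real n)\<^sup>2 * t))
      = exp (2 * of_real pi * \<i> * of_real (real n * (x $ j - r $ j * t) + (real n)\<^sup>2 * t))" for n j
  proof -
    obtain m where m: "k $ j = of_int m"
      using assms[of j] by (elim Ints_cases)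
    have "2 * of_real pi * \<i> * of_real (real n * ((x + k) $ j - r $ j * t) + (real n)\<^sup>2 * t)
      = 2 * of_real pi * \<i> * of_real (real n * (x $ j - r $ j * t) + (real n)\<^sup>2 * t)
        + of_real (of_int (2 * (int n * m)) * pi) * \<i>"
      by (simp add: m algebra_simps)
    then show ?thesis
      unfolding exp_eq by blast
  qed
  then show ?thesis
    by (simp add: weyl_product_def)
qed

lemma weyl_maximal_periodic:
  assumes "\<And>j. k $ j \<in> \<int>"
  shows "weyl_maximal r N (x + k) = weyl_maximal r N x"
  by (simp add: weyl_maximal_def weyl_product_periodic[OF assms])

lemma borel_measurable_weyl_maximal: "weyl_maximal r N \<in> borel_measurable borel"
proof (rule borel_measurableI_greater)
  fix a
  have "a < weyl_maximal r N x \<longleftrightarrow> (\<exists>t\<in>{0<..<1}. a < norm (weyl_product r N t x))" for x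
    unfolding weyl_maximal_def by (rule less_cSUP_iff[OF _ bdd_above_weyl_product]) simp
  then have "{x \<in> space borel. a < weyl_maximal r N x}
      = (\<Union>t\<in>{0<..<1}. {x. a < norm (weyl_product r N t x)})"
    by auto
  moreover have "open {x. a < norm (weyl_product r N t x)}" for t
    unfolding weyl_product_def by (intro open_Collect_less continuous_intros)
  ultimately show "{x \<in> space borel. a < weyl_maximal r N x} \<in> sets borel"
    by (auto intro!: borel_open)
qed

lemma integrable_weyl_maximal:
  fixes r :: "real ^ 'd"
  assumes "0 < p"
  shows "integrable torus_measure (\<lambda>x. \<bar>weyl_maximal r N x\<bar> powr p)"
proof -
  let ?Q = "{x :: real ^ 'd. \<forall>j. 0 \<le> x $ j \<and> x $ j < 1}"
  have Q: "?Q = (\<Inter>j. {x. 0 \<le> x $ j} \<inter> {x. x $ j < 1})" by auto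
  have "?Q \<in> sets borel"
    unfolding Q
    by (intro sets.countable_INT'' sets.Int borel_closed borel_open closed_Collect_le
          open_Collect_less continuous_intros) auto
  moreover have "bounded ?Q"
    by (rule bounded_subset[OF bounded_cbox[of 0 1]]) (auto simp: mem_box_cart less_imp_le)
  ultimately have lm: "?Q \<in> lmeasurable"
    by (intro bounded_set_imp_lmeasurable) auto
  interpret finite_measure "torus_measure :: (real ^ 'd) measure"
    unfolding torus_measure_def using lm by (rule finite_measure_lebesgue_on)
  show ?thesis
  proof (rule integrable_const_bound[where B = "(real N ^ CARD('d)) powr p"])
    show "AE x in torus_measure. norm (\<bar>weyl_maximal r N x\<bar> powr p) \<le> (real N ^ CARD('d)) powr p"
      using assms by (auto intro!: powr_mono2 simp: weyl_maximal_bounds)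
    have "weyl_maximal r N \<in> borel_measurable torus_measure"
      unfolding torus_measure_def
      by (intro measurable_restrict_space1 measurable_completion)
        (simp add: borel_measurable_weyl_maximal)
    then show "(\<lambda>x. \<bar>weyl_maximal r N x\<bar> powr p) \<in> borel_measurable torus_measure"
      by measurable
  qed
qed

end

(* At the critical exponent c = 2(d+1)/d the p-norm is controlled by one pointwise bound.
   Choose q <= 16 N with |t - a/q| <= 1/(16 q N) by Dirichlet. Completing with Gauss sums and
   estimating the remaining sums with tiny quadratic coefficient by Kusmin-Landau gives, for the
   nearest fraction b/q to y,
     |sum_{n<=N} e(n y + n^2 t)|^2 << (log N)^2 N / (q (1/N + |y - b/q|)),
   in which t only enters through q. Since r is rational with denominator R, substituting
   y = x_j - r_j t only moves the centre b/q to a multiple of 1/(R q), up to O(1/N). So the supremum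
   over t is bounded by a maximum over q of a product of functions of the x_j, and replacing the
   maximum by a sum and integrating coordinatewise yields N^(d+2) sum_{q<=16N} 1/q up to logarithms.
   The other exponents follow from pointwise comparison with the critical one. *)
theory Submission
  imports Defs
begin

section \<open>The Kusmin-Landau inequality for quadratic phases\<close>


text \<open>The bound has to survive a supremum over \<open>t\<close>, so it may depend neither on
  \<open>a\<close> nor on the size of \<open>t - a / q\<close>. One denominator serves all
  coordinates, whereas the numerators vary with the coordinate and with \<open>t\<close>. Summing
  over all numerators in each coordinate separately restores a product structure, and the cost is
  affordable: with \<theta> = 1 + 1/d the d factors contribute q^(-d \<theta>) = q^(-(d+1)), there
  are about (R q)^d tuples of numerators, and each tuple integrates to about N^(d (\<theta> - 1)) =
  N, so that q enters as 1/q. This singles out 2 \<theta> as the exponent at which the sum over q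
  diverges only logarithmically. The strict inequality imposed on s pays for the logarithms. The 16
  in Dirichlet's theorem keeps the drift of the phase increments, at most 3 N \<bar>\<beta>\<bar>,
  below 3/(16 q), which is small against the spacing 1/q of the completed frequencies.\<close>

definition ec :: "real \<Rightarrow> complex" where "ec x = cis (2 * pi * x)"

lemma ec_add: "ec (x + y) = ec x * ec y"
  by (simp add: ec_def cis_mult ring_distribs)

lemma norm_ec [simp]: "norm (ec x) = 1"
  by (simp add: ec_def)

lemma ec_of_int [simp]: "ec (of_int k) = 1"
  by (simp add: ec_def)

lemma ec_minus: "ec (- x) = cnj (ec x)"
  by (simp add: ec_def cis_cnj)

lemma ec_power: "ec x ^ n = ec (real n * x)"
  unfolding ec_def Complex.DeMoivre by (simp add: mult.left_commute)

lemma norm_ec_minus_1: "norm (ec x - 1) = 2 * \<bar>sin (pi * x)\<bar>"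
proof -
  have "ec x - 1 = cis (pi * x) * (cis (pi * x) - cis (- (pi * x)))"
    by (simp add: ec_def right_diff_distrib cis_mult mult_ac)
  also have "cis (pi * x) - cis (- (pi * x)) = 2 * \<i> * sin (pi * x)"
    by (simp add: complex_eq_iff)
  finally show ?thesis
    by (simp add: norm_mult)
qed

lemma norm_ec_diff_le: "norm (ec x - ec y) \<le> 2 * pi * \<bar>x - y\<bar>"
proof -
  have "ec x - ec y = ec y * (ec (x - y) - 1)"
    using ec_add[of y "x - y"] by (simp add: algebra_simps)
  then have "norm (ec x - ec y) = 2 * \<bar>sin (pi * (x - y))\<bar>"
    by (simp add: norm_mult norm_ec_minus_1)
  also have "\<dots> \<le> 2 * \<bar>pi * (x - y)\<bar>"
    using abs_sin_x_le_abs_x[of "pi * (x - y)"] by linarith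
  finally show ?thesis by (simp add: abs_mult)
qed

text \<open>The value is fitted to \<open>25 / 2 * pi \<le> 40\<close>, the constant of the
  telescoping estimate.\<close>

lemma pi_less_16_5: "pi < 16 / 5"
  using pi_approx by simp

text \<open>Up to \<open>pi / 3\<close> the derivative is at least 1/2; beyond it the sine stays
  above \<open>sqrt 3 / 2\<close>, which exceeds \<open>pi / 4\<close>.\<close>

lemma sin_ge_half:
  assumes "0 \<le> x" "x \<le> pi / 2"
  shows "x / 2 \<le> sin x"
proof (cases "x \<le> pi / 3")
  case True
  show ?thesis
  proof (cases "x = 0")
    case False
    then have "0 < x" using assms by simp
    then obtain z where z: "0 < z" "z < x" "sin x - sin 0 = (x - 0) * cos z"
      using MVT2[of 0 x sin cos] by (auto intro!: derivative_eq_intros)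
    have "cos (pi / 3) \<le> cos z"
      using z True by (intro cos_monotone_0_pi_le) auto
    then show ?thesis
      using z \<open>0 < x\<close> by (simp add: cos_60)
  qed auto
next
  case False
  have "sin (pi / 3) \<le> sin x"
    using False assms by (intro sin_monotone_2pi_le) auto
  moreover have "17 / 10 \<le> sqrt 3"
    by (rule real_le_rsqrt) (simp add: power2_eq_square)
  moreover have "x / 2 \<le> 17 / 20"
    using assms pi_less_16_5 by linarith
  ultimately show ?thesis by (simp add: sin_60)
qed

text \<open>Among the integers only 0 lies in this window, so the chord vanishes only at
  \<open>g = 0\<close>. The window reaches past 1/2 because the completed frequencies may overshoot
  1/2; there the reflection \<open>g\<close> to \<open>1 - g\<close> is used, with a margin of
  1/8.\<close>

lemma norm_ec_minus_1_ge:
  assumes "\<bar>g\<bar> \<le> 7 / 8"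
  shows "2 / 5 * \<bar>g\<bar> \<le> norm (ec g - 1)"
proof -
  have *: "g / 5 \<le> sin (pi * g)" if "0 \<le> g" "g \<le> 7 / 8" for g
  proof (cases "g \<le> 1 / 2")
    case True
    have "g / 5 \<le> pi * g / 2"
      using that pi_gt3 mult_right_mono[of 3 pi g] by linarith
    also have "\<dots> \<le> sin (pi * g)"
      using that True by (intro sin_ge_half) auto
    finally show ?thesis .
  next
    case False
    have "g / 5 \<le> 3 * (1 - g) / 2" using that by simp
    also have "\<dots> \<le> pi * (1 - g) / 2"
      using that pi_gt3 by (intro divide_right_mono mult_right_mono) auto
    also have "\<dots> \<le> sin (pi * (1 - g))"
      using that False by (intro sin_ge_half) auto
    also have "\<dots> = sin (pi * g)"
      by (simp add: right_diff_distrib)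
    finally show ?thesis .
  qed
  have "\<bar>g\<bar> / 5 \<le> sin (pi * \<bar>g\<bar>)"
    using assms by (intro *) auto
  also have "\<dots> \<le> \<bar>sin (pi * g)\<bar>"
    by (cases "g \<ge> 0") (auto simp: abs_real_def)
  finally show ?thesis by (simp add: norm_ec_minus_1)
qed

text \<open>The phase increments \<open>g k\<close> are affine in \<open>k\<close>, so consecutive differences of
  \<open>1 / (ec (g k) - 1)\<close> are controlled by those of \<open>1 / g k\<close>, which telescope.\<close>

lemma kusmin_landau_quadratic_pos:
  fixes \<beta> \<gamma> \<delta> :: real
  defines "g \<equiv> \<lambda>k::nat. \<beta> * (2 * real k + 1) + \<gamma>"
  assumes "m \<le> n" and "0 < \<delta>"
    and g: "\<And>k. m \<le> k \<Longrightarrow> k \<le> n \<Longrightarrow> \<delta> \<le> g k \<and> g k \<le> 7 / 8"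
  shows "norm (\<Sum>k=m..n. ec (\<beta> * (real k)\<^sup>2 + \<gamma> * real k)) \<le> 45 / \<delta>"
proof -
  define E where "E \<equiv> \<lambda>k::nat. ec (\<beta> * (real k)\<^sup>2 + \<gamma> * real k)"
  define c where "c \<equiv> \<lambda>k. 1 / (ec (g k) - 1)"
  \<comment> \<open>The sign makes \<open>\<sigma> * (g (Suc k) - g k)\<close> the absolute
    increment, so increasing and decreasing phases telescope alike.\<close>
  define \<sigma> :: real where "\<sigma> = (if \<beta> \<ge> 0 then 1 else -1)"
  have E_Suc: "E (Suc k) = E k * ec (g k)" for k
    unfolding E_def g_def ec_add[symmetric] by (rule arg_cong[of _ _ ec]) (simp add: power2_eq_square algebra_simps)
  have nE: "norm (E k) = 1" for k by (simp add: E_def)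
  have lower: "2 / 5 * g k \<le> norm (ec (g k) - 1)" "0 < g k" if "m \<le> k" "k \<le> n" for k
    using norm_ec_minus_1_ge[of "g k"] g[OF that] \<open>0 < \<delta>\<close> by auto
  have nz: "ec (g k) - 1 \<noteq> 0" if "m \<le> k" "k \<le> n" for k
    using lower[OF that] by auto
  have nc: "norm (c k) \<le> (5 / 2) / \<delta>" if "m \<le> k" "k \<le> n" for k
  proof -
    have "2 / 5 * \<delta> \<le> norm (ec (g k) - 1)"
      using lower[OF that] g[OF that] by linarith
    then have "1 / norm (ec (g k) - 1) \<le> 1 / (2 / 5 * \<delta>)"
      using \<open>0 < \<delta>\<close> by (intro divide_left_mono) (auto intro!: mult_pos_pos)
    then show ?thesis by (simp add: c_def norm_divide)
  qed
  have dc: "norm (c k - c (Suc k)) \<le> 40 * (\<sigma> * (1 / g k - 1 / g (Suc k)))" if "m \<le> k" "Suc k \<le> n" for k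
  proof -
    note l = lower[of k] lower[of "Suc k"] nz[of k] nz[of "Suc k"]
    have "norm (c k - c (Suc k)) = norm (ec (g (Suc k)) - ec (g k)) / (norm (ec (g k) - 1) * norm (ec (g (Suc k)) - 1))"
      using l that by (simp add: c_def diff_frac_eq norm_divide norm_mult)
    also have "\<dots> \<le> (2 * pi * \<bar>g (Suc k) - g k\<bar>) / ((2 / 5 * g k) * (2 / 5 * g (Suc k)))"
      using l that by (intro frac_le mult_mono norm_ec_diff_le) (auto intro!: mult_pos_pos mult_nonneg_nonneg less_imp_le[of 0 "g _"])
    also have "\<dots> = (25 / 2 * pi) * (\<bar>g (Suc k) - g k\<bar> / (g k * g (Suc k)))"
      by simp
    also have "\<dots> \<le> 40 * (\<bar>g (Suc k) - g k\<bar> / (g k * g (Suc k)))"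
      using l that pi_less_16_5 by (intro mult_right_mono) (auto intro!: divide_nonneg_pos)
    also have "\<bar>g (Suc k) - g k\<bar> = \<sigma> * (g (Suc k) - g k)"
      by (simp add: g_def \<sigma>_def algebra_simps)
    also have "\<sigma> * (g (Suc k) - g k) / (g k * g (Suc k)) = \<sigma> * (1 / g k - 1 / g (Suc k))"
    proof -
      have "1 / g k - 1 / g (Suc k) = (g (Suc k) - g k) / (g k * g (Suc k))"
        using l that by (simp add: diff_frac_eq)
      then show ?thesis by simp
    qed
    finally show ?thesis .
  qed
  \<comment> \<open>Summation by parts, from \<open>E k = (E (Suc k) - E k) * c k\<close>. Keeping
    the upper boundary term on the left makes the statement inductive. The two boundary terms cost
    5/2 each and the telescoped variation 40, in units of 1/\<delta>; together 45.\<close>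
  have "norm ((\<Sum>k=m..n. E k) - E (Suc n) * c n) \<le> (5 / 2) / \<delta> + 40 * (\<sigma> * (1 / g m - 1 / g n))"
    using \<open>m \<le> n\<close>
  proof (induction rule: dec_induct)
    case base
    have "E m - E (Suc m) * c m = - E m * c m"
      using nz[of m] \<open>m \<le> n\<close> by (simp add: E_Suc c_def field_simps)
    then show ?case
      using nc[of m] \<open>m \<le> n\<close> by (simp add: norm_mult nE)
  next
    case (step k)
    have E: "E (Suc k) + E (Suc k) * c (Suc k) - E (Suc (Suc k)) * c (Suc k) = 0"
      using nz[of "Suc k"] step.hyps by (simp add: E_Suc[of "Suc k"] c_def field_simps)
    have "(\<Sum>k=m..Suc k. E k) - E (Suc (Suc k)) * c (Suc k)
        = ((\<Sum>k=m..k. E k) - E (Suc k) * c k) + E (Suc k) * (c k - c (Suc k))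
          + (E (Suc k) + E (Suc k) * c (Suc k) - E (Suc (Suc k)) * c (Suc k))"
      using step.hyps by (simp add: algebra_simps)
    also have "norm \<dots> \<le> norm ((\<Sum>k=m..k. E k) - E (Suc k) * c k) + norm (c k - c (Suc k))"
      unfolding E by (simp add: norm_triangle_le norm_mult nE)
    also have "\<dots> \<le> ((5 / 2) / \<delta> + 40 * (\<sigma> * (1 / g m - 1 / g k))) + 40 * (\<sigma> * (1 / g k - 1 / g (Suc k)))"
      using step by (intro add_mono dc) auto
    finally show ?case by (simp add: algebra_simps)
  qed
  moreover have "\<sigma> * (1 / g m - 1 / g n) \<le> 1 / \<delta>"
  proof -
    have "1 / g m \<le> 1 / \<delta>" "1 / g n \<le> 1 / \<delta>" "0 < 1 / g m" "0 < 1 / g n"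
      using g[of m] g[of n] lower(2)[of m] lower(2)[of n] \<open>m \<le> n\<close> \<open>0 < \<delta>\<close> by (auto intro!: divide_left_mono)
    then have "1 / g m - 1 / g n \<le> 1 / \<delta>" "1 / g n - 1 / g m \<le> 1 / \<delta>"
      by linarith+
    then show ?thesis by (simp add: \<sigma>_def)
  qed
  moreover have "norm (E (Suc n) * c n) \<le> (5 / 2) / \<delta>"
    using nc[of n] \<open>m \<le> n\<close> by (simp add: norm_mult nE)
  ultimately have "norm (\<Sum>k=m..n. E k) \<le> (5 / 2) / \<delta> + (5 / 2) / \<delta> + 40 * (1 / \<delta>)"
    using norm_triangle_sub[of "\<Sum>k=m..n. E k" "E (Suc n) * c n"] by linarith
  then show ?thesis by (simp add: E_def)
qed

text \<open>An affine \<open>g\<close> is monotone, so the indices with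
  \<open>g k \<ge> \<delta>\<close> and those with \<open>g k \<le> - \<delta>\<close> each form an
  interval. The one-sided bound applies to both, to the negative one after complex conjugation; the
  remaining near-stationary indices are counted trivially.\<close>

lemma kusmin_landau_quadratic:
  fixes \<beta> \<gamma> \<delta> :: real
  defines "g \<equiv> \<lambda>k::nat. \<beta> * (2 * real k + 1) + \<gamma>"
  assumes small: "\<And>k. 1 \<le> k \<Longrightarrow> k \<le> N \<Longrightarrow> \<bar>g k\<bar> \<le> 7 / 8" and "0 < \<delta>"
  shows "norm (\<Sum>k=1..N. ec (\<beta> * (real k)\<^sup>2 + \<gamma> * real k))
       \<le> real (card {k\<in>{1..N}. \<bar>g k\<bar> < \<delta>}) + 90 / \<delta>"
proof -
  define E where "E \<equiv> \<lambda>k::nat. ec (\<beta> * (real k)\<^sup>2 + \<gamma> * real k)"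
  let ?P = "{k\<in>{1..N}. \<delta> \<le> g k}" and ?M = "{k\<in>{1..N}. g k \<le> - \<delta>}" and ?Z = "{k\<in>{1..N}. \<bar>g k\<bar> < \<delta>}"
  have interval: "\<exists>m M. m \<le> M \<and> A = {m..M}"
    if "A \<noteq> {}" "finite A" "\<And>i j k. i \<in> A \<Longrightarrow> k \<in> A \<Longrightarrow> i \<le> j \<Longrightarrow> j \<le> k \<Longrightarrow> j \<in> A" for A :: "nat set"
  proof (intro exI conjI equalityI subsetI)
    show "Min A \<le> Max A" using that(1,2) by simp
    fix j assume "j \<in> {Min A..Max A}"
    then show "j \<in> A" using that(3)[OF Min_in[OF that(2,1)] Max_in[OF that(2,1)]] by simp
  qed (use that(2) in simp)
  have between: "min (g i) (g k) \<le> g j \<and> g j \<le> max (g i) (g k)" if "i \<le> j" "j \<le> k" for i j k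
  proof (cases "\<beta> \<ge> 0")
    case True
    have "g i \<le> g j" "g j \<le> g k"
      using that True unfolding g_def by (auto intro!: add_mono mult_left_mono)
    then show ?thesis by auto
  next
    case False
    have "g i \<ge> g j" "g j \<ge> g k"
      using that False unfolding g_def by (auto intro!: add_mono mult_left_mono_neg)
    then show ?thesis by auto
  qed
  have P: "norm (\<Sum>k\<in>?P. E k) \<le> 45 / \<delta>"
  proof (cases "?P = {}")
    case False
    have "\<exists>m M. m \<le> M \<and> ?P = {m..M}"
    proof (rule interval[OF False])
      fix i j k assume "i \<in> ?P" "k \<in> ?P" "i \<le> j" "j \<le> k"
      then show "j \<in> ?P" using between[of i j k] by auto
    qed simp
    then obtain m M where mM: "m \<le> M" "?P = {m..M}" by blast
    have "\<delta> \<le> g k \<and> g k \<le> 7 / 8" if "m \<le> k" "k \<le> M" for k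
    proof -
      have "k \<in> ?P" unfolding mM(2) using that by simp
      then show ?thesis using small[of k] by auto
    qed
    with mM(1) have "norm (\<Sum>k=m..M. E k) \<le> 45 / \<delta>"
      unfolding E_def g_def using \<open>0 < \<delta>\<close> by (intro kusmin_landau_quadratic_pos) auto
    then show ?thesis unfolding mM(2) .
  next
    case True
    show ?thesis unfolding True using \<open>0 < \<delta>\<close> by simp
  qed
  have M: "norm (\<Sum>k\<in>?M. E k) \<le> 45 / \<delta>"
  proof (cases "?M = {}")
    case False
    have "\<exists>m M. m \<le> M \<and> ?M = {m..M}"
    proof (rule interval[OF False])
      fix i j k assume "i \<in> ?M" "k \<in> ?M" "i \<le> j" "j \<le> k"
      then show "j \<in> ?M" using between[of i j k] by auto
    qed simp
    then obtain m M where mM: "m \<le> M" "?M = {m..M}" by blast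
    have "\<delta> \<le> (-\<beta>) * (2 * real k + 1) + (-\<gamma>) \<and> (-\<beta>) * (2 * real k + 1) + (-\<gamma>) \<le> 7 / 8"
      if "m \<le> k" "k \<le> M" for k
    proof -
      have "k \<in> ?M" unfolding mM(2) using that by simp
      then have "g k \<le> - \<delta>" "\<bar>g k\<bar> \<le> 7 / 8" using small[of k] by auto
      moreover have "(-\<beta>) * (2 * real k + 1) + (-\<gamma>) = - g k" by (simp add: g_def)
      ultimately show ?thesis by linarith
    qed
    with mM(1) have "norm (\<Sum>k=m..M. ec ((-\<beta>) * (real k)\<^sup>2 + (-\<gamma>) * real k)) \<le> 45 / \<delta>"
      using \<open>0 < \<delta>\<close> by (intro kusmin_landau_quadratic_pos) auto
    moreover have "(\<Sum>k=m..M. ec ((-\<beta>) * (real k)\<^sup>2 + (-\<gamma>) * real k)) = cnj (\<Sum>k=m..M. E k)"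
      unfolding cnj_sum E_def ec_minus[symmetric] by simp
    ultimately show ?thesis unfolding mM(2) by (simp only: complex_mod_cnj)
  next
    case True
    show ?thesis unfolding True using \<open>0 < \<delta>\<close> by simp
  qed
  have Z: "norm (\<Sum>k\<in>?Z. E k) \<le> real (card ?Z)"
    by (rule order_trans[OF norm_sum]) (simp add: E_def)
  have "{1..N} = (?P \<union> ?M) \<union> ?Z" by auto
  then have "(\<Sum>k=1..N. E k) = (\<Sum>k\<in>(?P \<union> ?M) \<union> ?Z. E k)" by (rule arg_cong)
  also have "\<dots> = (\<Sum>k\<in>?P \<union> ?M. E k) + (\<Sum>k\<in>?Z. E k)"
    by (rule sum.union_disjoint) auto
  also have "(\<Sum>k\<in>?P \<union> ?M. E k) = (\<Sum>k\<in>?P. E k) + (\<Sum>k\<in>?M. E k)"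
    using \<open>0 < \<delta>\<close> by (intro sum.union_disjoint) auto
  finally have "(\<Sum>k=1..N. E k) = (\<Sum>k\<in>?P. E k) + (\<Sum>k\<in>?M. E k) + (\<Sum>k\<in>?Z. E k)" .
  also have "norm \<dots> \<le> 45 / \<delta> + 45 / \<delta> + real (card ?Z)"
    by (intro norm_triangle_mono P M Z)
  finally show ?thesis by (simp add: E_def)
qed


text \<open>Consecutive values are \<open>2 * \<bar>\<beta>\<bar>\<close> apart and the admissible
  window has length \<open>2 * \<delta>\<close>; the 1 accounts for the endpoint.\<close>

lemma card_affine_near_zero_le:
  fixes \<beta> \<gamma> \<delta> :: real
  assumes "\<beta> \<noteq> 0" "0 < \<delta>"
  shows "real (card {k\<in>{1..N}. \<bar>\<beta> * (2 * real k + 1) + \<gamma>\<bar> < \<delta>}) \<le> \<delta> / \<bar>\<beta>\<bar> + 1"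
proof -
  let ?A = "{k\<in>{1..N}. \<bar>\<beta> * (2 * real k + 1) + \<gamma>\<bar> < \<delta>}"
  have fin: "finite ?A" by (rule finite_subset[of _ "{1..N}"]) auto
  show ?thesis
  proof (cases "?A = {}")
    case True
    then show ?thesis using assms by (simp only: True card.empty) simp
  next
    case False
    define m where "m = Min ?A"
    define M where "M = Max ?A"
    have m: "\<bar>\<beta> * (2 * real m + 1) + \<gamma>\<bar> < \<delta>"
      using Min_in[OF fin False] unfolding m_def[symmetric] by blast
    have M: "\<bar>\<beta> * (2 * real M + 1) + \<gamma>\<bar> < \<delta>"
      using Max_in[OF fin False] unfolding M_def[symmetric] by blast
    have "m \<le> M"
      unfolding m_def M_def by (intro Min_le fin Max_in False)
    have "?A \<subseteq> {m..M}"
      using fin unfolding m_def M_def by (meson Max_ge Min_le atLeastAtMost_iff subsetI)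
    then have "card ?A \<le> card {m..M}"
      by (intro card_mono) auto
    also have "\<dots> = Suc M - m" by simp
    finally have "real (card ?A) \<le> real M - real m + 1"
      using \<open>m \<le> M\<close> by linarith
    moreover have "\<bar>\<beta>\<bar> * (2 * (real M - real m)) \<le> 2 * \<delta>"
    proof -
      have "\<bar>\<beta>\<bar> * (2 * (real M - real m)) = \<bar>\<beta> * (2 * (real M - real m))\<bar>"
        using \<open>m \<le> M\<close> by (simp add: abs_mult)
      also have "\<dots> = \<bar>(\<beta> * (2 * real M + 1) + \<gamma>) - (\<beta> * (2 * real m + 1) + \<gamma>)\<bar>"
        by (simp add: algebra_simps)
      also have "\<dots> \<le> 2 * \<delta>" using m M by linarith
      finally show ?thesis .
    qed
    then have "real M - real m \<le> \<delta> / \<bar>\<beta>\<bar>"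
      using assms by (simp add: field_simps)
    ultimately show ?thesis by linarith
  qed
qed

text \<open>Rests on 2 k + 1 \<le> 3 N, and is the source of every
  \<open>3 * real N * \<bar>\<beta>\<bar>\<close> below.\<close>

lemma phase_deviation_le:
  assumes "1 \<le> k" "k \<le> N"
  shows "\<bar>\<beta> * (2 * real k + 1)\<bar> \<le> 3 * real N * \<bar>\<beta> :: real\<bar>"
proof -
  have "\<bar>\<beta>\<bar> * \<bar>2 * real k + 1\<bar> \<le> \<bar>\<beta>\<bar> * (3 * real N)"
    using assms by (intro mult_left_mono) auto
  then show ?thesis by (simp add: abs_mult mult_ac)
qed

text \<open>The drift is at most half of \<open>\<bar>\<gamma>\<bar>\<close>, so no increment is
  smaller than \<open>\<bar>\<gamma>\<bar> / 2\<close>. With this threshold the exceptional set is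
  empty and 90 becomes 180.\<close>

lemma quadratic_sum_le_nonstationary:
  fixes \<beta> \<gamma> :: real
  assumes "\<bar>\<gamma>\<bar> + 3 * real N * \<bar>\<beta>\<bar> \<le> 7 / 8" "\<gamma> \<noteq> 0" "6 * real N * \<bar>\<beta>\<bar> \<le> \<bar>\<gamma>\<bar>"
  shows "norm (\<Sum>k=1..N. ec (\<beta> * (real k)\<^sup>2 + \<gamma> * real k)) \<le> 180 / \<bar>\<gamma>\<bar>"
proof -
  have "norm (\<Sum>k=1..N. ec (\<beta> * (real k)\<^sup>2 + \<gamma> * real k))
      \<le> real (card {k\<in>{1..N}. \<bar>\<beta> * (2 * real k + 1) + \<gamma>\<bar> < \<bar>\<gamma>\<bar> / 2}) + 90 / (\<bar>\<gamma>\<bar> / 2)"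
  proof (rule kusmin_landau_quadratic)
    fix k assume "1 \<le> k" "k \<le> N"
    from phase_deviation_le[OF this, of \<beta>] show "\<bar>\<beta> * (2 * real k + 1) + \<gamma>\<bar> \<le> 7 / 8"
      using assms(1) by linarith
  qed (use assms in auto)
  also have "{k\<in>{1..N}. \<bar>\<beta> * (2 * real k + 1) + \<gamma>\<bar> < \<bar>\<gamma>\<bar> / 2} = {}"
  proof -
    have "\<not> \<bar>\<beta> * (2 * real k + 1) + \<gamma>\<bar> < \<bar>\<gamma>\<bar> / 2" if "1 \<le> k" "k \<le> N" for k
      using phase_deviation_le[OF that, of \<beta>] assms(3) by linarith
    then show ?thesis by auto
  qed
  finally show ?thesis by simp
qed

lemma norm_sum_ec_le: "norm (\<Sum>k=1..N. ec (f k)) \<le> real N"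
  by (rule order_trans[OF norm_sum]) simp

text \<open>In the stationary range the second derivative test gives \<open>1 / \<bar>\<beta>\<bar>\<close>, and there \<open>\<beta>\<close> has size at least
  \<open>\<bar>\<gamma>\<bar> / (6 N)\<close>; this is why the bound can be stated without \<open>\<beta>\<close>.\<close>

lemma quadratic_sum_squared_le:
  fixes \<beta> \<gamma> :: real
  assumes "N \<ge> 1" "\<bar>\<gamma>\<bar> + 3 * real N * \<bar>\<beta>\<bar> \<le> 7 / 8"
  shows "(norm (\<Sum>k=1..N. ec (\<beta> * (real k)\<^sup>2 + \<gamma> * real k)))\<^sup>2 \<le> 110000 * real N / (1 / real N + \<bar>\<gamma>\<bar>)"
    (is "(norm ?T)\<^sup>2 \<le> _")
proof -
  have N: "0 < real N" using assms by simp
  have TN: "norm ?T \<le> real N" by (rule norm_sum_ec_le)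
  consider "\<bar>\<gamma>\<bar> \<le> 1 / real N" | "1 / real N < \<bar>\<gamma>\<bar>" "6 * real N * \<bar>\<beta>\<bar> \<le> \<bar>\<gamma>\<bar>"
    | "1 / real N < \<bar>\<gamma>\<bar>" "\<bar>\<gamma>\<bar> < 6 * real N * \<bar>\<beta>\<bar>"
    by linarith
  then show ?thesis
  proof cases
    case 1
    have "(norm ?T)\<^sup>2 \<le> (real N)\<^sup>2" using TN by (intro power_mono) auto
    also have "\<dots> = 2 * real N / (2 / real N)" using N by (simp add: power2_eq_square)
    also have "\<dots> \<le> 110000 * real N / (1 / real N + \<bar>\<gamma>\<bar>)"
      using 1 N by (intro frac_le add_pos_nonneg) auto
    finally show ?thesis .
  next
    case 2
    have g: "0 < \<bar>\<gamma>\<bar>" using 2(1) N by (meson divide_pos_pos less_trans zero_less_one)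
    have "norm ?T \<le> 180 / \<bar>\<gamma>\<bar>"
      using assms 2 g by (intro quadratic_sum_le_nonstationary) auto
    \<comment> \<open>Only one factor of the square uses the nonstationary bound; the other is
      bounded by N, which gives the common shape N / \<bar>\<gamma>\<bar>.\<close>
    then have "(norm ?T)\<^sup>2 \<le> real N * (180 / \<bar>\<gamma>\<bar>)"
      using TN unfolding power2_eq_square by (intro mult_mono) auto
    also have "\<dots> = 360 * real N / (2 * \<bar>\<gamma>\<bar>)" by simp
    also have "\<dots> \<le> 110000 * real N / (1 / real N + \<bar>\<gamma>\<bar>)"
      using 2 N by (intro frac_le add_pos_nonneg) auto
    finally show ?thesis .
  next
    case 3
    have g: "0 < \<bar>\<gamma>\<bar>" using 3(1) N by (meson divide_pos_pos less_trans zero_less_one)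
    have b: "0 < \<bar>\<beta>\<bar>" using 3 g by (auto intro: ccontr)
    \<comment> \<open>The square root balances the count
      \<open>\<delta> / \<bar>\<beta>\<bar>\<close> against \<open>90 / \<delta>\<close>. Since
      \<open>\<bar>\<beta>\<bar> \<le> 1\<close>, the extra 1 in the count is also at most
      \<open>1 / \<delta>\<close>, whence 92.\<close>
    define \<delta> where "\<delta> = sqrt \<bar>\<beta>\<bar>"
    have d: "0 < \<delta>" "\<delta>\<^sup>2 = \<bar>\<beta>\<bar>" using b by (auto simp: \<delta>_def)
    have "\<bar>\<beta>\<bar> \<le> 1"
    proof -
      have "\<bar>\<beta>\<bar> * 1 \<le> \<bar>\<beta>\<bar> * (3 * real N)" using assms(1) by (intro mult_left_mono) auto
      then show ?thesis using assms(2) by (simp add: mult_ac)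
    qed
    then have d1: "1 \<le> 1 / \<delta>" using d by (simp add: \<delta>_def)
    have "norm ?T \<le> real (card {k\<in>{1..N}. \<bar>\<beta> * (2 * real k + 1) + \<gamma>\<bar> < \<delta>}) + 90 / \<delta>"
    proof (rule kusmin_landau_quadratic)
      fix k assume "1 \<le> k" "k \<le> N"
      from phase_deviation_le[OF this, of \<beta>] show "\<bar>\<beta> * (2 * real k + 1) + \<gamma>\<bar> \<le> 7 / 8"
        using assms(2) by linarith
    qed (use d in auto)
    also have "\<dots> \<le> (\<delta> / \<bar>\<beta>\<bar> + 1) + 90 / \<delta>"
      using b d by (intro add_right_mono card_affine_near_zero_le) auto
    also have "\<delta> / \<bar>\<beta>\<bar> = 1 / \<delta>"
      using d by (simp add: power2_eq_square flip: d(2))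
    also have "1 / \<delta> + 1 + 90 / \<delta> \<le> 92 / \<delta>"
      using d1 by (simp add: field_simps)
    finally have "(norm ?T)\<^sup>2 \<le> (92 / \<delta>)\<^sup>2"
      by (intro power_mono) auto
    also have "\<dots> = 8464 / \<bar>\<beta>\<bar>" by (simp add: power_divide d)
    \<comment> \<open>In the stationary case 1 / \<bar>\<beta>\<bar> is below 6 N /
      \<bar>\<gamma>\<bar>. The product 8464 * 12 = 101568 is the largest constant of the three
      cases and explains 110000.\<close>
    also have "\<dots> \<le> 8464 * (12 * real N / (2 * \<bar>\<gamma>\<bar>))"
      using b g 3(2) by (simp add: field_simps)
    also have "\<dots> = 101568 * real N / (2 * \<bar>\<gamma>\<bar>)" by simp
    also have "\<dots> \<le> 110000 * real N / (1 / real N + \<bar>\<gamma>\<bar>)"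
      using 3 N by (intro frac_le add_pos_nonneg) auto
    finally show ?thesis .
  qed
qed

section \<open>Completion by Gauss sums\<close>


lemma ec_eq_1_iff: "ec x = 1 \<longleftrightarrow> x \<in> \<int>"
proof
  assume "ec x = 1"
  then have "sin (pi * x) = 0" using norm_ec_minus_1[of x] by simp
  then obtain i :: int where "pi * x = of_int i * pi" by (auto simp: sin_zero_iff_int2)
  then show "x \<in> \<int>" by simp
qed (auto elim: Ints_cases)

lemma sum_ec_complete_residues:
  assumes "0 < q"
  shows "(\<Sum>j<q. ec (real j * of_int c / real q)) = (if int q dvd c then of_nat q else 0)"
proof (cases "int q dvd c")
  case True
  then obtain k where c: "c = int q * k" by blast
  have "real j * of_int c / real q = of_int (int j * k)" for j
    using assms by (simp add: c)
  then have "ec (real j * of_int c / real q) = 1" for j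
    by (metis ec_of_int)
  then show ?thesis using True by simp
next
  case False
  define z where "z = ec (of_int c / real q)"
  have "z \<noteq> 1"
  proof
    assume "z = 1"
    then obtain k :: int where "of_int c / real q = of_int k"
      unfolding z_def ec_eq_1_iff by (auto elim: Ints_cases)
    then have "real_of_int c = real_of_int (int q * k)"
      using assms by (simp add: field_simps)
    then show False using False by (metis dvd_triv_left of_int_eq_iff)
  qed
  moreover have "z ^ q = 1"
    using assms by (simp add: z_def ec_power)
  moreover have "(\<Sum>j<q. ec (real j * of_int c / real q)) = (\<Sum>j<q. z ^ j)"
    by (simp add: z_def ec_power)
  ultimately show ?thesis
    using False geometric_sum[of z q] by simp
qed

text \<open>A shift by one exchanges \<open>F c\<close> for \<open>F (c + q)\<close>, which agree by
  periodicity; integer induction iterates this in both directions.\<close>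

lemma sum_periodic_shift:
  fixes F :: "int \<Rightarrow> 'a :: ab_group_add"
  assumes "\<And>x. F (x + int q) = F x"
  shows "(\<Sum>j<q. F (int j + c)) = (\<Sum>j<q. F (int j))"
proof -
  have step: "(\<Sum>j<q. F (int j + (c + 1))) = (\<Sum>j<q. F (int j + c))" for c
  proof -
    have "(\<Sum>j<Suc q. F (int j + c)) = F c + (\<Sum>j<q. F (int j + (c + 1)))"
      by (subst sum.lessThan_Suc_shift) (simp add: add_ac)
    moreover have "(\<Sum>j<Suc q. F (int j + c)) = (\<Sum>j<q. F (int j + c)) + F c"
      using assms[of c] by (simp add: add.commute)
    ultimately show ?thesis by (simp add: add.commute)
  qed
  show ?thesis
  proof (induction c rule: int_induct[where k = 0])
    case (step2 i)
    then show ?case using step[of "i - 1"] by simp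
  qed (use step in simp_all)
qed

definition gauss_sum :: "int \<Rightarrow> int \<Rightarrow> nat \<Rightarrow> complex" where
  "gauss_sum a b q = (\<Sum>m<q. ec ((of_int a * (real m)\<^sup>2 + of_int b * real m) / real q))"

text \<open>Expanding the square and shifting one variable by the other cancels the quadratic term
  in \<open>m\<close> and leaves linear sums over complete residue systems. These vanish unless q
  divides 2 a h, hence 2 h by coprimality, which forces h to be 0 or q / 2. The second possibility
  causes the factor 2.\<close>

lemma norm_gauss_sum_squared_le:
  assumes "coprime a (int q)" "0 < q"
  shows "(norm (gauss_sum a b q))\<^sup>2 \<le> 2 * real q"
proof -
  define E where "E \<equiv> \<lambda>m::int. ec (of_int (a * m\<^sup>2 + b * m) / real q)"
  have G: "gauss_sum a b q = (\<Sum>m<q. E (int m))"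
    by (simp add: gauss_sum_def E_def)
  have per: "E (x + int q) = E x" for x
  proof -
    have "of_int (a * (x + int q)\<^sup>2 + b * (x + int q)) / real q
        = of_int (a * x\<^sup>2 + b * x) / real q + of_int (a * (2 * x + int q) + b)"
      using assms(2) by (simp add: field_simps power2_eq_square)
    then show ?thesis by (simp only: E_def ec_add ec_of_int) simp
  qed
  have E_shift: "E (int h + int m) * cnj (E (int m)) = E (int h) * ec (real m * of_int (2 * a * int h) / real q)" for h m
  proof -
    have "of_int (a * (int h + int m)\<^sup>2 + b * (int h + int m)) / real q + - (of_int (a * (int m)\<^sup>2 + b * int m) / real q)
       = of_int (a * (int h)\<^sup>2 + b * int h) / real q + real m * of_int (2 * a * int h) / real q"
      using assms(2) by (simp add: field_simps power2_eq_square)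
    then show ?thesis unfolding E_def ec_minus[symmetric] ec_add[symmetric] by simp
  qed
  have "gauss_sum a b q * cnj (gauss_sum a b q) = (\<Sum>m<q. (\<Sum>h<q. E (int h)) * cnj (E (int m)))"
    by (simp add: G cnj_sum sum_distrib_left)
  also have "\<dots> = (\<Sum>m<q. (\<Sum>h<q. E (int h + int m)) * cnj (E (int m)))"
    by (subst sum_periodic_shift) (auto simp: per)
  also have "\<dots> = (\<Sum>m<q. \<Sum>h<q. E (int h) * ec (real m * of_int (2 * a * int h) / real q))"
    by (simp only: sum_distrib_right E_shift)
  also have "\<dots> = (\<Sum>h<q. E (int h) * (\<Sum>m<q. ec (real m * of_int (2 * a * int h) / real q)))"
    by (subst sum.swap) (simp add: sum_distrib_left)
  finally have "norm (gauss_sum a b q * cnj (gauss_sum a b q))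
      \<le> (\<Sum>h<q. norm (E (int h) * (\<Sum>m<q. ec (real m * of_int (2 * a * int h) / real q))))"
    by (simp only: norm_sum)
  also have "\<dots> = (\<Sum>h<q. if int q dvd 2 * a * int h then real q else 0)"
    by (intro sum.cong refl) (simp only: sum_ec_complete_residues[OF assms(2)] norm_mult, simp add: E_def)
  also have "\<dots> = real (card {h\<in>{..<q}. int q dvd 2 * a * int h}) * real q"
    by (simp add: sum.If_cases Int_def)
  finally have *: "norm (gauss_sum a b q * cnj (gauss_sum a b q)) \<le> real (card {h\<in>{..<q}. int q dvd 2 * a * int h}) * real q" .
  have "card {h\<in>{..<q}. int q dvd 2 * a * int h} \<le> card {0, q div 2}"
  proof (intro card_mono subsetI)
    fix h assume "h \<in> {h\<in>{..<q}. int q dvd 2 * a * int h}"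
    then have h: "h < q" "int q dvd a * (2 * int h)" by (auto simp: mult_ac)
    then have "int q dvd 2 * int h"
      using assms(1) by (simp add: coprime_dvd_mult_right_iff coprime_commute)
    then have "q dvd 2 * h" by presburger
    then obtain k where k: "2 * h = q * k" by blast
    with h have "k < 2" by (metis mult_less_cancel1 mult.commute mult_less_mono2 not_less_iff_gr_or_eq zero_less_numeral nat_mult_less_cancel_disj)
    then have "k = 0 \<or> k = 1" by auto
    then show "h \<in> {0, q div 2}" using k by auto
  qed auto
  also have "card {0, q div 2} \<le> 2" by (simp add: card_insert_if)
  finally have "real (card {h\<in>{..<q}. int q dvd 2 * a * int h}) * real q \<le> 2 * real q"
    by (intro mult_right_mono) auto
  with * show ?thesis
    by (simp add: norm_mult power2_eq_square)
qed

text \<open>Additive characters modulo q detect the residue m of n, which separates the arithmetic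
  phase from the smooth one. The offset \<open>c\<close> is free because any q consecutive
  frequencies will do; it is later used to centre them at the fraction nearest to
  \<open>y\<close>.\<close>

lemma quadratic_sum_completion:
  fixes a c :: int
  assumes "0 < q"
  shows "of_nat q * (\<Sum>n=1..N. ec (real n * y + (real n)\<^sup>2 * (of_int a / real q + \<beta>)))
      = (\<Sum>j<q. gauss_sum a (int j + c) q * (\<Sum>n=1..N. ec (\<beta> * (real n)\<^sup>2 + (y - of_int (int j + c) / real q) * real n)))"
proof -
  have inner: "(\<Sum>j<q. ec (of_int (int j + c) * (real m - real n) / real q))
      = (if m = n mod q then of_nat q else 0)" if "m < q" for m n
  proof -
    have "ec (of_int (int j + c) * (real m - real n) / real q)
        = ec (of_int c * (real m - real n) / real q) * ec (real j * of_int (int m - int n) / real q)" for j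
      unfolding ec_add[symmetric] using assms by (intro arg_cong[of _ _ ec]) (simp add: field_simps)
    then have "(\<Sum>j<q. ec (of_int (int j + c) * (real m - real n) / real q))
        = ec (of_int c * (real m - real n) / real q) * (if int q dvd int m - int n then of_nat q else 0)"
      by (simp only: sum_distrib_left[symmetric] sum_ec_complete_residues[OF assms])
    moreover have "int q dvd int m - int n \<longleftrightarrow> m = n mod q"
    proof -
      have "int q dvd int m - int n \<longleftrightarrow> int m mod int q = int n mod int q"
        by (simp add: mod_eq_dvd_iff)
      also have "\<dots> \<longleftrightarrow> m mod q = n mod q"
        by (simp flip: of_nat_mod)
      finally show ?thesis using that by simp
    qed
    \<comment> \<open>If m is the residue of n, then m - n is a multiple of q and the offset drops
      out.\<close>
    moreover have "ec (of_int c * (real (n mod q) - real n) / real q) = 1"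
    proof -
      have "real n = real (q * (n div q) + n mod q)" by simp
      then have "of_int c * (real (n mod q) - real n) / real q = of_int (- c * int (n div q))"
        using assms by (simp only: of_nat_add of_nat_mult) simp
      then show ?thesis by (simp only: ec_of_int)
    qed
    ultimately show ?thesis by simp
  qed
  have square: "ec (of_int a * (real (n mod q))\<^sup>2 / real q) = ec (of_int a * (real n)\<^sup>2 / real q)" for n
  proof -
    have n: "real n = real q * real (n div q) + real (n mod q)"
      by (simp flip: of_nat_mult of_nat_add)
    have "of_int a * (real n)\<^sup>2 / real q = of_int a * (real (n mod q))\<^sup>2 / real q
        + of_int (a * int (n div q) * (int q * int (n div q) + 2 * int (n mod q)))"
      unfolding n using assms by (simp add: field_simps power2_eq_square)
    then show ?thesis by (simp only: ec_add ec_of_int) simp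
  qed
  have "(\<Sum>j<q. gauss_sum a (int j + c) q * (\<Sum>n=1..N. ec (\<beta> * (real n)\<^sup>2 + (y - of_int (int j + c) / real q) * real n)))
      = (\<Sum>j<q. \<Sum>m<q. \<Sum>n=1..N. ec ((of_int a * (real m)\<^sup>2 + of_int (int j + c) * real m) / real q)
          * ec (\<beta> * (real n)\<^sup>2 + (y - of_int (int j + c) / real q) * real n))"
    by (simp only: gauss_sum_def sum_product)
  also have "\<dots> = (\<Sum>j<q. \<Sum>m<q. \<Sum>n=1..N. ec (of_int a * (real m)\<^sup>2 / real q) * ec (\<beta> * (real n)\<^sup>2 + y * real n)
          * ec (of_int (int j + c) * (real m - real n) / real q))"
    unfolding ec_add[symmetric]
    using assms by (intro sum.cong refl arg_cong[of _ _ ec]) (simp add: field_simps)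
  also have "\<dots> = (\<Sum>m<q. \<Sum>n=1..N. \<Sum>j<q. ec (of_int a * (real m)\<^sup>2 / real q) * ec (\<beta> * (real n)\<^sup>2 + y * real n)
          * ec (of_int (int j + c) * (real m - real n) / real q))"
    by (rule trans[OF sum.swap sum.cong[OF refl sum.swap]])
  also have "\<dots> = (\<Sum>m<q. \<Sum>n=1..N. ec (of_int a * (real m)\<^sup>2 / real q) * ec (\<beta> * (real n)\<^sup>2 + y * real n)
          * (if m = n mod q then of_nat q else 0))"
    by (intro sum.cong refl) (simp only: sum_distrib_left[symmetric] inner lessThan_iff)
  also have "\<dots> = (\<Sum>n=1..N. \<Sum>m<q. if m = n mod q
          then ec (of_int a * (real m)\<^sup>2 / real q) * ec (\<beta> * (real n)\<^sup>2 + y * real n) * of_nat q else 0)"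
    by (subst sum.swap, intro sum.cong refl) simp
  also have "\<dots> = (\<Sum>n=1..N. ec (of_int a * (real (n mod q))\<^sup>2 / real q) * ec (\<beta> * (real n)\<^sup>2 + y * real n) * of_nat q)"
    using assms by (simp add: sum.delta)
  also have "\<dots> = (\<Sum>n=1..N. of_nat q * ec (real n * y + (real n)\<^sup>2 * (of_int a / real q + \<beta>)))"
  proof (intro sum.cong refl)
    fix n
    have "ec (of_int a * (real n)\<^sup>2 / real q) * ec (\<beta> * (real n)\<^sup>2 + y * real n) = ec (real n * y + (real n)\<^sup>2 * (of_int a / real q + \<beta>))"
      unfolding ec_add[symmetric] by (rule arg_cong[of _ _ ec]) (simp add: algebra_simps)
    then show "ec (of_int a * (real (n mod q))\<^sup>2 / real q) * ec (\<beta> * (real n)\<^sup>2 + y * real n) * of_nat q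
        = of_nat q * ec (real n * y + (real n)\<^sup>2 * (of_int a / real q + \<beta>))"
      by (simp only: square mult.commute)
  qed
  finally show ?thesis by (simp add: sum_distrib_left)
qed

section \<open>Weyl sums near rationals\<close>


text \<open>The difference of \<open>harm\<close> and \<open>ln\<close> is decreasing and equals 1
  at n = 1.\<close>

lemma harm_le_1_plus_ln:
  assumes "0 < n"
  shows "(harm n :: real) \<le> 1 + ln (real n)"
proof -
  have "harm (Suc (n - 1)) - ln (real (Suc (n - 1))) \<le> harm (Suc 0) - ln (real (Suc 0))"
    by (rule decseqD[OF decseq_harm_diff_ln]) simp
  then show ?thesis using assms by (simp add: harm_expand)
qed

text \<open>On either side of K the distances are distinct elements of 1..q, hence two harmonic
  sums.\<close>

lemma sum_inverse_dist_le:
  assumes "K < q"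
  shows "(\<Sum>j\<in>{..<q}-{K}. 1 / \<bar>real j - real K\<bar>) \<le> 2 * (1 + ln (real q))"
proof -
  have *: "(\<Sum>j\<in>A. 1 / \<bar>real j - real K\<bar>) \<le> harm q"
    if "inj_on h A" "h ` A \<subseteq> {1..q}" "\<And>j. j \<in> A \<Longrightarrow> \<bar>real j - real K\<bar> = real (h j)" for h A
  proof -
    have "(\<Sum>j\<in>A. 1 / \<bar>real j - real K\<bar>) = (\<Sum>j\<in>A. inverse (real (h j)))"
      by (intro sum.cong refl) (simp add: that(3) inverse_eq_divide)
    also have "\<dots> = (\<Sum>k\<in>h ` A. inverse (real k))"
      by (simp add: sum.reindex[OF that(1)])
    also have "\<dots> \<le> harm q"
      unfolding harm_def using that(2) by (intro sum_mono2) auto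
    finally show ?thesis .
  qed
  have split: "{..<q} - {K} = {..<K} \<union> {K<..<q}" using assms by auto
  have "(\<Sum>j\<in>{..<q}-{K}. 1 / \<bar>real j - real K\<bar>)
      = (\<Sum>j\<in>{..<K}. 1 / \<bar>real j - real K\<bar>) + (\<Sum>j\<in>{K<..<q}. 1 / \<bar>real j - real K\<bar>)"
    unfolding split by (rule sum.union_disjoint) auto
  also have "\<dots> \<le> harm q + harm q"
  proof (rule add_mono)
    show "(\<Sum>j\<in>{..<K}. 1 / \<bar>real j - real K\<bar>) \<le> harm q"
      using assms by (intro *[of "\<lambda>j. K - j"]) (auto simp: inj_on_def of_nat_diff)
    show "(\<Sum>j\<in>{K<..<q}. 1 / \<bar>real j - real K\<bar>) \<le> harm q"
      using assms by (intro *[of "\<lambda>j. j - K"]) (auto simp: inj_on_def of_nat_diff)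
  qed
  also have "\<dots> \<le> 2 * (1 + ln (real q))"
    using harm_le_1_plus_ln[of q] assms by simp
  finally show ?thesis .
qed

text \<open>From \<open>ln 16 \<le> 3\<close>; enlarging the range of denominators to 16 N costs
  only a constant factor in the logarithm.\<close>

lemma one_plus_ln_le:
  assumes "1 \<le> N" "0 < q" "q \<le> 16 * N"
  shows "1 + ln (real q) \<le> 4 * (1 + ln (real N))"
proof -
  have "ln (16 :: real) = ln (2 ^ 4)" by simp
  also have "\<dots> = 4 * ln 2" by (subst ln_realpow) auto
  finally have "ln (16 :: real) \<le> 3" using ln_2_less_1 ln2_le_25_over_36 by simp
  have "0 \<le> ln (real N)" using assms by simp
  have "ln (real q) \<le> ln (16 * real N)"
    using assms by (subst ln_le_cancel_iff) (auto simp flip: of_nat_mult)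
  also have "\<dots> = ln 16 + ln (real N)"
    using assms by (subst ln_mult) auto
  finally show ?thesis
    using \<open>ln (16 :: real) \<le> 3\<close> \<open>0 \<le> ln (real N)\<close> by simp
qed

text \<open>Only the central completed frequency, at offset \<open>\<eta>\<close> with
  \<bar>\<eta>\<bar> \<le> 1/(2q), can be stationary, and it yields the main term. Every other one
  has offset at least \<bar>j - K\<bar>/(2q), so the nonstationary bound applies and these terms add
  up to O(q log q). The Gauss sums contribute sqrt(2q), against the factor q gained from
  completion.\<close>

lemma weyl_sum_near_rational:
  fixes a :: int and \<beta> y :: real
  assumes N: "1 \<le> N" and q: "0 < q" "q \<le> 16 * N" and "coprime a (int q)"
    and \<beta>: "\<bar>\<beta>\<bar> \<le> 1 / (16 * real q * real N)"
  shows "\<exists>b::int. (norm (\<Sum>n=1..N. ec (real n * y + (real n)\<^sup>2 * (of_int a / real q + \<beta>))))\<^sup>2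
      \<le> 10 ^ 10 * (1 + ln (real N))\<^sup>2 * real N / (real q * (1 / real N + \<bar>y - of_int b / real q\<bar>))"
proof -
  define S where "S = (\<Sum>n=1..N. ec (real n * y + (real n)\<^sup>2 * (of_int a / real q + \<beta>)))"
  define b where "b = round (real q * y)"
  define \<eta> where "\<eta> = y - of_int b / real q"
  \<comment> \<open>With the centre in the middle of the residue system, \<bar>j - K\<bar> \<le> q/2
    for all j < q, which keeps all frequencies inside the window 7/8.\<close>
  define K where "K = (q - 1) div 2"
  define c where "c = b - int K"
  define T where "T j = (\<Sum>n=1..N. ec (\<beta> * (real n)\<^sup>2 + (y - of_int (int j + c) / real q) * real n))" for j
  define Y where "Y = real N / (1 / real N + \<bar>\<eta>\<bar>)"
  have q0: "0 < real q" and N0: "0 < real N" using q N by auto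
  have "\<bar>of_int b - real q * y\<bar> \<le> 1 / 2"
    unfolding b_def by (rule of_int_round_abs_le)
  then have "\<bar>real q * \<eta>\<bar> \<le> 1 / 2"
    using q0 by (simp add: \<eta>_def right_diff_distrib abs_minus_commute)
  then have \<eta>: "\<bar>\<eta>\<bar> \<le> 1 / (2 * real q)"
    using q0 by (simp add: abs_mult field_simps)
  have N\<beta>: "real N * \<bar>\<beta>\<bar> \<le> 1 / (16 * real q)"
    using mult_left_mono[OF \<beta>, of "real N"] N0 by simp
  have K: "K < q" using q by (auto simp: K_def)
  have TK: "(norm (T K))\<^sup>2 \<le> 110000 * Y"
  proof -
    have eq: "y - of_int (int K + c) / real q = \<eta>" by (simp add: c_def \<eta>_def)
    have "1 / (2 * real q) + 3 * (1 / (16 * real q)) \<le> 7 / 8"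
      using q by (simp add: field_simps)
    then have "\<bar>\<eta>\<bar> + 3 * real N * \<bar>\<beta>\<bar> \<le> 7 / 8"
      using \<eta> N\<beta> by linarith
    from quadratic_sum_squared_le[OF N this] show ?thesis
      unfolding T_def eq by (simp add: Y_def)
  qed
  have Tj: "norm (T j) \<le> 360 * real q * (1 / \<bar>real j - real K\<bar>)" if j: "j < q" "j \<noteq> K" for j
  proof -
    define k where "k = real j - real K"
    define \<gamma> where "\<gamma> = y - of_int (int j + c) / real q"
    have \<gamma>: "\<gamma> = \<eta> - k / real q"
      by (simp add: \<gamma>_def c_def \<eta>_def k_def diff_divide_distrib add_divide_distrib)
    have k: "1 \<le> \<bar>k\<bar>" "\<bar>k\<bar> \<le> real q / 2" and q2: "2 \<le> q"
      using j unfolding k_def K_def by linarith+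
    have k2q: "1 / (2 * real q) \<le> \<bar>k\<bar> / (2 * real q)"
      using k q0 by (intro divide_right_mono) auto
    have "\<bar>k\<bar> / real q - \<bar>\<eta>\<bar> \<le> \<bar>\<gamma>\<bar>" "\<bar>\<gamma>\<bar> \<le> \<bar>\<eta>\<bar> + \<bar>k\<bar> / real q"
      using q0 abs_triangle_ineq2[of "k / real q" \<eta>] abs_triangle_ineq4[of \<eta> "k / real q"]
      by (auto simp: \<gamma> abs_minus_commute)
    moreover have "\<bar>k\<bar> / real q = 2 * (\<bar>k\<bar> / (2 * real q))" by simp
    ultimately have g1: "\<bar>k\<bar> / (2 * real q) \<le> \<bar>\<gamma>\<bar>" and g2: "\<bar>\<gamma>\<bar> \<le> 1 / (2 * real q) + \<bar>k\<bar> / real q"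
      using \<eta> k2q by linarith+
    have "0 < 1 / (2 * real q)" using q0 by simp
    then have kq: "0 < \<bar>k\<bar> / (2 * real q)" using k2q by (rule less_le_trans)
    then have g0: "0 < \<bar>\<gamma>\<bar>" using g1 by (rule less_le_trans)
    have "\<bar>k\<bar> / real q \<le> 1 / 2" using k(2) q0 by (simp add: pos_divide_le_eq)
    moreover have "1 / (2 * real q) + 3 * (1 / (16 * real q)) \<le> 3 / 8"
      using q2 by (simp add: field_simps)
    ultimately have h1: "\<bar>\<gamma>\<bar> + 3 * real N * \<bar>\<beta>\<bar> \<le> 7 / 8"
      using g2 N\<beta> by linarith
    \<comment> \<open>The 16 in the bound on \<open>\<beta>\<close> acts here: 6/16 \<le> 1/2 puts
      twice the drift below the smallest noncentral offset 1/(2q).\<close>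
    have h2: "6 * real N * \<bar>\<beta>\<bar> \<le> \<bar>\<gamma>\<bar>"
    proof -
      have "6 * real N * \<bar>\<beta>\<bar> \<le> 6 * (1 / (16 * real q))" using N\<beta> by linarith
      also have "\<dots> \<le> 1 / (2 * real q)" using q0 by (simp add: field_simps)
      also have "\<dots> \<le> \<bar>\<gamma>\<bar>" using g1 k2q by linarith
      finally show ?thesis .
    qed
    have "norm (T j) \<le> 180 / \<bar>\<gamma>\<bar>"
      unfolding T_def \<gamma>_def[symmetric] using g0 by (intro quadratic_sum_le_nonstationary h1 h2) auto
    also have "\<dots> \<le> 180 / (\<bar>k\<bar> / (2 * real q))"
      by (rule divide_left_mono[OF g1 _ mult_pos_pos[OF g0 kq]]) simp
    finally show ?thesis by (simp add: k_def)
  qed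
  define R where "R = 720 * real q * (1 + ln (real q))"
  have "(\<Sum>j\<in>{..<q}-{K}. norm (T j)) \<le> (\<Sum>j\<in>{..<q}-{K}. 360 * real q * (1 / \<bar>real j - real K\<bar>))"
    by (intro sum_mono Tj) auto
  also have "\<dots> \<le> 360 * real q * (2 * (1 + ln (real q)))"
    unfolding sum_distrib_left[symmetric] by (intro mult_left_mono sum_inverse_dist_le K) auto
  also have "\<dots> = R" by (simp add: R_def algebra_simps)
  finally have "(\<Sum>j\<in>{..<q}-{K}. norm (T j)) \<le> R" .
  then have sumT: "(\<Sum>j<q. norm (T j)) \<le> norm (T K) + R"
    using K by (subst sum.remove[of _ K]) auto
  have G: "norm (gauss_sum a (int j + c) q) \<le> sqrt (2 * real q)" for j
    using norm_gauss_sum_squared_le[OF \<open>coprime a (int q)\<close> q(1)] by (rule real_le_rsqrt)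
  have "real q * norm S = norm (of_nat q * S)" by (simp add: norm_mult)
  also have "of_nat q * S = (\<Sum>j<q. gauss_sum a (int j + c) q * T j)"
    unfolding S_def T_def by (rule quadratic_sum_completion[OF q(1)])
  also have "norm \<dots> \<le> (\<Sum>j<q. sqrt (2 * real q) * norm (T j))"
    by (rule sum_norm_le) (auto simp: norm_mult intro!: mult_right_mono G)
  also have "\<dots> \<le> sqrt (2 * real q) * (norm (T K) + R)"
    unfolding sum_distrib_left[symmetric] by (intro mult_left_mono sumT) auto
  finally have "(real q * norm S)\<^sup>2 \<le> (sqrt (2 * real q) * (norm (T K) + R))\<^sup>2"
    by (intro power_mono) auto
  also have "\<dots> = 2 * real q * (norm (T K) + R)\<^sup>2"
    by (simp add: power_mult_distrib)
  also have "\<dots> \<le> 2 * real q * (2 * (norm (T K))\<^sup>2 + 2 * R\<^sup>2)"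
    using sum_squares_ge_zero[of "norm (T K) - R" 0]
    by (intro mult_left_mono) (auto simp: power2_eq_square algebra_simps)
  also have "\<dots> = 4 * real q * ((norm (T K))\<^sup>2 + R\<^sup>2)" by simp
  \<comment> \<open>The value 720^2 * 264 * 4^2 = 2189721600, increased by the 110000 of the central
    term, is rounded up; four times the result stays below 10^10.\<close>
  also have "\<dots> \<le> 4 * real q * (2190000000 * (1 + ln (real N))\<^sup>2 * Y)"
  proof (intro mult_left_mono)
    define L where "L = 1 + ln (real N)"
    have "1 \<le> L" using N by (simp add: L_def)
    then have L2: "1 \<le> L\<^sup>2" by (simp add: one_le_power)
    have Y0: "0 \<le> Y" unfolding Y_def using N0 by (intro divide_nonneg_nonneg) auto
    \<comment> \<open>This absorbs the error O(q log q) into the main term: q \<le> 16 N gives 1/N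
      \<le> 16/q, and with \<bar>\<eta>\<bar> \<le> 1/(2q) the denominator of \<open>Y\<close> is at
      most 33/(2q). A second use of q \<le> 16 N gives 33/2 * 16 = 264.\<close>
    have qY: "(real q)\<^sup>2 \<le> 264 * Y"
    proof -
      have "1 / real N \<le> 16 / real q" using q N0 by (simp add: field_simps flip: of_nat_mult)
      moreover have "33 / (2 * real q) = 16 / real q + 1 / (2 * real q)" by (simp add: field_simps)
      ultimately have "1 / real N + \<bar>\<eta>\<bar> \<le> 33 / (2 * real q)" using \<eta> by linarith
      then have "(real q)\<^sup>2 * (1 / real N + \<bar>\<eta>\<bar>) \<le> (real q)\<^sup>2 * (33 / (2 * real q))"
        by (rule mult_left_mono) simp
      also have "\<dots> = 33 / 2 * real q" using q0 by (simp add: power2_eq_square)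
      also have "\<dots> \<le> 264 * real N" using q by simp
      finally have "(real q)\<^sup>2 * (1 / real N + \<bar>\<eta>\<bar>) \<le> 264 * real N" .
      moreover have "0 < 1 / real N + \<bar>\<eta>\<bar>" using N0 by (intro add_pos_nonneg) auto
      ultimately show ?thesis by (simp add: Y_def pos_le_divide_eq)
    qed
    have "R\<^sup>2 = 518400 * ((real q)\<^sup>2 * (1 + ln (real q))\<^sup>2)"
      by (simp add: R_def power_mult_distrib)
    also have "\<dots> \<le> 518400 * ((264 * Y) * (4 * L)\<^sup>2)"
      using one_plus_ln_le[OF N q] q qY Y0 unfolding L_def
      by (intro mult_left_mono mult_mono power_mono) auto
    also have "\<dots> = 2189721600 * (L\<^sup>2 * Y)" by (simp add: power_mult_distrib)
    finally have "R\<^sup>2 \<le> 2189721600 * (L\<^sup>2 * Y)" .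
    moreover have "1 * Y \<le> L\<^sup>2 * Y" using L2 Y0 by (rule mult_right_mono)
    ultimately have "(norm (T K))\<^sup>2 + R\<^sup>2 \<le> 2190000000 * (L\<^sup>2 * Y)"
      using TK Y0 by linarith
    then show "(norm (T K))\<^sup>2 + R\<^sup>2 \<le> 2190000000 * (1 + ln (real N))\<^sup>2 * Y"
      by (simp add: L_def)
  qed simp
  finally have "real q * (real q * (norm S)\<^sup>2) \<le> real q * (8760000000 * ((1 + ln (real N))\<^sup>2 * Y))"
    by (simp add: power2_eq_square mult_ac)
  then have "real q * (norm S)\<^sup>2 \<le> 8760000000 * ((1 + ln (real N))\<^sup>2 * Y)"
    using q0 by (rule mult_left_le_imp_le)
  also have "\<dots> \<le> 10 ^ 10 * ((1 + ln (real N))\<^sup>2 * Y)"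
  proof (rule mult_right_mono)
    have "0 \<le> Y" unfolding Y_def using N0 by (intro divide_nonneg_nonneg) auto
    then show "0 \<le> (1 + ln (real N))\<^sup>2 * Y" by simp
  qed simp
  finally have "(norm S)\<^sup>2 \<le> 10 ^ 10 * ((1 + ln (real N))\<^sup>2 * Y) / real q"
    using q0 by (simp only: pos_le_divide_eq mult.commute[of "(norm S)\<^sup>2"])
  also have "\<dots> = 10 ^ 10 * (1 + ln (real N))\<^sup>2 * real N / (real q * (1 / real N + \<bar>y - of_int b / real q\<bar>))"
    unfolding Y_def \<eta>_def
    by (simp only: times_divide_eq_right divide_divide_eq_left mult.assoc mult.commute[of "real q"])
  finally show ?thesis unfolding S_def by (rule exI)
qed

text \<open>Both \<open>q\<close> and \<open>a\<close> are fixed before \<open>y\<close>; this order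
  of quantifiers lets one denominator serve all coordinates. Of the Dirichlet approximation only the
  distance 1/N is kept, the resolution at which the position of a centre matters.\<close>

lemma weyl_sum_Dirichlet:
  fixes t :: real
  assumes "1 \<le> N"
  shows "\<exists>q (a::int). 0 < q \<and> q \<le> 16 * N \<and> \<bar>t - of_int a / real q\<bar> \<le> 1 / real N \<and>
    (\<forall>y. \<exists>b::int. (norm (\<Sum>n=1..N. ec (real n * y + (real n)\<^sup>2 * t)))\<^sup>2
      \<le> 10 ^ 10 * (1 + ln (real N))\<^sup>2 * real N / (real q * (1 / real N + \<bar>y - of_int b / real q\<bar>)))"
proof -
  have N0: "0 < real N" and "0 < 16 * N" using assms by auto
  from Dirichlet_approx_coprime[OF this(2), of t] obtain a k where
    ak: "coprime a k" "0 < k" "k \<le> int (16 * N)" "\<bar>of_int k * t - of_int a\<bar> < 1 / real (16 * N)" .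
  define q where "q = nat k"
  have q: "0 < q" "q \<le> 16 * N" "k = int q" using ak by (auto simp: q_def)
  define \<beta> where "\<beta> = t - of_int a / real q"
  have "real q * \<bar>\<beta>\<bar> = \<bar>real q * \<beta>\<bar>" by (simp add: abs_mult)
  also have "real q * \<beta> = of_int k * t - of_int a"
    using q by (simp add: \<beta>_def right_diff_distrib)
  finally have "real q * \<bar>\<beta>\<bar> = \<bar>of_int k * t - of_int a\<bar>" .
  then have "real q * \<bar>\<beta>\<bar> \<le> 1 / (16 * real N)" using ak(4) by simp
  then have \<beta>: "\<bar>\<beta>\<bar> \<le> 1 / (16 * real q * real N)"
    using q(1) N0 by (simp add: field_simps)
  also have "\<dots> \<le> 1 / real N"
    using q(1) N0 by (intro divide_left_mono) auto
  finally have near: "\<bar>t - of_int a / real q\<bar> \<le> 1 / real N" by (simp add: \<beta>_def)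
  have bound: "\<exists>b::int. (norm (\<Sum>n=1..N. ec (real n * y + (real n)\<^sup>2 * t)))\<^sup>2
      \<le> 10 ^ 10 * (1 + ln (real N))\<^sup>2 * real N / (real q * (1 / real N + \<bar>y - of_int b / real q\<bar>))" for y
  proof -
    have t: "of_int a / real q + \<beta> = t" by (simp add: \<beta>_def)
    have "coprime a (int q)" using ak(1) q(3) by simp
    from weyl_sum_near_rational[OF assms q(1,2) this \<beta>, of y] show ?thesis
      unfolding t .
  qed
  show ?thesis
    by (rule exI[of _ q], rule exI[of _ a]) (intro conjI allI q(1,2) near bound)
qed

section \<open>From the pointwise bound to the critical exponent\<close>


text \<open>For r = k/R and l = k a + R b one has x - l/(R q) = (x - r t - b/q) + r (t - a/q). The
  last term is at most \<bar>r\<bar>/N and is absorbed into 1/N at the price of the factor 1 +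
  \<bar>r\<bar>. Again \<open>q\<close> is chosen before \<open>r\<close> and
  \<open>x\<close>.\<close>

lemma weyl_sum_near_fraction:
  fixes t :: real
  assumes N: "1 \<le> N" and R: "0 < R"
  shows "\<exists>q. 0 < q \<and> q \<le> 16 * N \<and> (\<forall>r x. (\<exists>k::int. real R * r = of_int k) \<longrightarrow> 0 \<le> x \<longrightarrow> x < 1 \<longrightarrow>
    (\<exists>m\<le>R * q. (norm (\<Sum>n=1..N. ec (real n * (x - r * t) + (real n)\<^sup>2 * t)))\<^sup>2
      \<le> 10 ^ 10 * (1 + \<bar>r\<bar>) * (1 + ln (real N))\<^sup>2 * real N
          / (real q * (1 / real N + \<bar>x - real m / real (R * q)\<bar>))))"
proof -
  from weyl_sum_Dirichlet[OF N, of t] obtain q and a :: int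
    where q: "0 < q" "q \<le> 16 * N" and near: "\<bar>t - of_int a / real q\<bar> \<le> 1 / real N"
    and bound: "\<And>y. \<exists>b::int. (norm (\<Sum>n=1..N. ec (real n * y + (real n)\<^sup>2 * t)))\<^sup>2
      \<le> 10 ^ 10 * (1 + ln (real N))\<^sup>2 * real N / (real q * (1 / real N + \<bar>y - of_int b / real q\<bar>))"
    by auto
  have q0: "0 < real q" and N0: "0 < real N" and R0: "0 < real R" using q N R by auto
  have main: "\<exists>m\<le>R * q. (norm (\<Sum>n=1..N. ec (real n * (x - r * t) + (real n)\<^sup>2 * t)))\<^sup>2
      \<le> 10 ^ 10 * (1 + \<bar>r\<bar>) * (1 + ln (real N))\<^sup>2 * real N
          / (real q * (1 / real N + \<bar>x - real m / real (R * q)\<bar>))"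
    if k: "real R * r = of_int k" and x: "0 \<le> x" "x < 1" for r x and k :: int
  proof -
    obtain b :: int where b: "(norm (\<Sum>n=1..N. ec (real n * (x - r * t) + (real n)\<^sup>2 * t)))\<^sup>2
      \<le> 10 ^ 10 * (1 + ln (real N))\<^sup>2 * real N / (real q * (1 / real N + \<bar>(x - r * t) - of_int b / real q\<bar>))"
      using bound by blast
    define D where "D = \<bar>(x - r * t) - of_int b / real q\<bar>"
    define l where "l = k * a + int R * b"
    \<comment> \<open>Clamping to 0..R q leaves finitely many possible centres. As x lies in [0,1),
      moving an outside centre to the endpoint 0 or 1 only brings it closer.\<close>
    define m where "m = nat (max 0 (min l (int (R * q))))"
    have "m \<le> R * q" by (simp add: m_def nat_le_iff)
    have Rq: "0 < real (R * q)" using R q by simp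
    have clamp: "\<bar>x - real m / real (R * q)\<bar> \<le> \<bar>x - of_int l / real (R * q)\<bar>"
    proof -
      consider "l < 0" | "0 \<le> l" "l \<le> int (R * q)" | "int (R * q) < l" by linarith
      then show ?thesis
      proof cases
        case 1
        then have "of_int l / real (R * q) \<le> 0" using Rq by (intro divide_nonpos_pos) auto
        then show ?thesis using 1 x by (simp add: m_def)
      next
        case 2
        then show ?thesis by (simp add: m_def)
      next
        case 3
        then have "m = R * q" by (simp add: m_def del: of_nat_mult)
        then have m: "real m / real (R * q) = 1" using R q by simp
        from 3 have "real (R * q) < of_int l" by linarith
        then have "1 \<le> of_int l / real (R * q)" using Rq by (simp only: pos_le_divide_eq)
        then show ?thesis unfolding m using x by linarith
      qed
    qed
    have "r = of_int k / real R" using k R0 by (simp add: field_simps)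
    then have "of_int l / real (R * q) = r * (of_int a / real q) + of_int b / real q"
      using R0 q0 by (simp add: l_def field_simps)
    then have "x - of_int l / real (R * q) = ((x - r * t) - of_int b / real q) + r * (t - of_int a / real q)"
      by (simp add: algebra_simps)
    then have "\<bar>x - of_int l / real (R * q)\<bar> \<le> D + \<bar>r\<bar> * \<bar>t - of_int a / real q\<bar>"
      unfolding D_def abs_mult[symmetric] by (simp only: abs_triangle_ineq)
    also have "\<dots> \<le> D + \<bar>r\<bar> * (1 / real N)"
      using near by (intro add_left_mono mult_left_mono) auto
    finally have "1 / real N + \<bar>x - real m / real (R * q)\<bar> \<le> 1 / real N + D + \<bar>r\<bar> * (1 / real N)"
      using clamp by linarith
    also have "\<dots> \<le> (1 + \<bar>r\<bar>) * (1 / real N + D)"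
    proof -
      have "0 \<le> \<bar>r\<bar> * D" by (simp add: D_def)
      moreover have "(1 + \<bar>r\<bar>) * (1 / real N + D) = 1 / real N + D + \<bar>r\<bar> * (1 / real N) + \<bar>r\<bar> * D"
        by (simp only: ring_distribs mult_1_left add_ac)
      ultimately show ?thesis by linarith
    qed
    finally have le: "real q * (1 / real N + \<bar>x - real m / real (R * q)\<bar>) \<le> (1 + \<bar>r\<bar>) * (real q * (1 / real N + D))"
      using q0 by (simp add: mult.left_commute)
    have pos: "0 < real q * (1 / real N + \<bar>x - real m / real (R * q)\<bar>)" "0 < real q * (1 / real N + D)"
      using q0 N0 unfolding D_def by (intro mult_pos_pos add_pos_nonneg; simp)+
    define A where "A = 10 ^ 10 * (1 + ln (real N))\<^sup>2 * real N"
    have A: "0 \<le> A" by (simp add: A_def)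
    have "A / (real q * (1 / real N + D)) = (1 + \<bar>r\<bar>) * A / ((1 + \<bar>r\<bar>) * (real q * (1 / real N + D)))"
      by (rule mult_divide_mult_cancel_left[symmetric]) (use abs_ge_zero[of r] in linarith)
    also have "\<dots> \<le> (1 + \<bar>r\<bar>) * A / (real q * (1 / real N + \<bar>x - real m / real (R * q)\<bar>))"
    proof (rule divide_left_mono[OF le])
      show "0 \<le> (1 + \<bar>r\<bar>) * A" using A by simp
      have "0 < 1 + \<bar>r\<bar>" by linarith
      then show "0 < (1 + \<bar>r\<bar>) * (real q * (1 / real N + D)) * (real q * (1 / real N + \<bar>x - real m / real (R * q)\<bar>))"
        by (intro mult_pos_pos[OF mult_pos_pos] pos)
    qed
    finally have "(norm (\<Sum>n=1..N. ec (real n * (x - r * t) + (real n)\<^sup>2 * t)))\<^sup>2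
        \<le> (1 + \<bar>r\<bar>) * A / (real q * (1 / real N + \<bar>x - real m / real (R * q)\<bar>))"
      using b unfolding A_def D_def by (rule order_trans[rotated])
    also have "(1 + \<bar>r\<bar>) * A = 10 ^ 10 * (1 + \<bar>r\<bar>) * (1 + ln (real N))\<^sup>2 * real N"
      by (simp add: A_def)
    finally show ?thesis using \<open>m \<le> R * q\<close> by (intro exI[of _ m] conjI)
  qed
  show ?thesis
    by (rule exI[of _ q]) (intro conjI q allI impI, elim exE, rule main)
qed

text \<open>The relevant numerator depends on \<open>t\<close>; the sum over all of them dominates
  the unknown term and is free of \<open>t\<close>. Both m = 0 and m = M occur, since a point near 1
  may belong to the centre 1.\<close>

definition spikes :: "real \<Rightarrow> nat \<Rightarrow> nat \<Rightarrow> real \<Rightarrow> real" where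
  "spikes \<theta> N M u = (\<Sum>m\<le>M. (1 / real N + \<bar>u - real m / real M\<bar>) powr (- \<theta>))"

lemma spikes_nonneg: "0 \<le> spikes \<theta> N M u"
  unfolding spikes_def by (intro sum_nonneg) auto

lemma borel_measurable_spikes [measurable]: "spikes \<theta> N M \<in> borel_measurable borel"
  unfolding spikes_def by measurable

text \<open>Translation removes \<open>c\<close>, and on each half-line a power is an
  antiderivative. Positivity of \<open>\<kappa>\<close> gives convergence at infinity, so the whole
  line can replace the unit interval.\<close>

lemma nn_integral_shifted_powr_le:
  fixes a c \<kappa> :: real
  assumes "0 < a" "0 < \<kappa>"
  shows "(\<integral>\<^sup>+u. ennreal ((a + \<bar>u - c\<bar>) powr (- (1 + \<kappa>))) \<partial>lborel) \<le> ennreal (2 * a powr (- \<kappa>) / \<kappa>)"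
proof -
  define g where "g u = (a + \<bar>u\<bar>) powr (- (1 + \<kappa>))" for u
  have g_borel [measurable]: "g \<in> borel_measurable borel"
    unfolding g_def by measurable
  have half: "(\<integral>\<^sup>+u. ennreal (g u) * indicator {0..} u \<partial>lborel) = ennreal (a powr (- \<kappa>) / \<kappa>)"
  proof -
    have "(\<integral>\<^sup>+u. ennreal (g u) * indicator {0..} u \<partial>lborel) = ennreal (0 - (- ((a + 0) powr (- \<kappa>) / \<kappa>)))"
    proof (rule nn_integral_FTC_atLeast)
      fix u :: real assume "0 \<le> u"
      then show "((\<lambda>u. - ((a + u) powr (- \<kappa>) / \<kappa>)) has_real_derivative g u) (at u)"
        using assms by (auto simp: g_def powr_diff powr_minus_divide intro!: derivative_eq_intros)
    next
      have "((\<lambda>u. (a + u) powr (- \<kappa>)) \<longlongrightarrow> 0) at_top"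
        by (rule tendsto_neg_powr) (use assms in \<open>auto intro: filterlim_tendsto_add_at_top[OF tendsto_const filterlim_ident]\<close>)
      then show "((\<lambda>u. - ((a + u) powr (- \<kappa>) / \<kappa>)) \<longlongrightarrow> 0) at_top"
        using tendsto_minus[OF tendsto_divide[OF _ tendsto_const, of _ 0 _ \<kappa>]] assms by fastforce
    qed (auto simp: g_def)
    then show ?thesis by simp
  qed
  have "(\<integral>\<^sup>+u. ennreal ((a + \<bar>u - c\<bar>) powr (- (1 + \<kappa>))) \<partial>lborel) = (\<integral>\<^sup>+u. ennreal (g u) \<partial>lborel)"
    by (subst nn_integral_real_affine[of _ 1 c]) (simp_all add: g_def)
  also have "\<dots> \<le> (\<integral>\<^sup>+u. ennreal (g u) * indicator {0..} u + ennreal (g (- u)) * indicator {0..} (- u) \<partial>lborel)"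
    by (rule nn_integral_mono) (auto simp: g_def indicator_def)
  also have "\<dots> = (\<integral>\<^sup>+u. ennreal (g u) * indicator {0..} u \<partial>lborel) + (\<integral>\<^sup>+u. ennreal (g (- u)) * indicator {0..} (- u) \<partial>lborel)"
    by (rule nn_integral_add) auto
  also have "(\<integral>\<^sup>+u. ennreal (g (- u)) * indicator {0..} (- u) \<partial>lborel) = (\<integral>\<^sup>+u. ennreal (g u) * indicator {0..} u \<partial>lborel)"
    by (subst (2) nn_integral_real_affine[of _ "- 1" 0]) auto
  also have "(\<integral>\<^sup>+u. ennreal (g u) * indicator {0..} u \<partial>lborel) + (\<integral>\<^sup>+u. ennreal (g u) * indicator {0..} u \<partial>lborel)
      = ennreal (2 * a powr (- \<kappa>) / \<kappa>)"
    unfolding half using assms by (subst ennreal_plus[symmetric]) auto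
  finally show ?thesis .
qed

lemma nn_integral_spikes_le:
  assumes "1 \<le> N" "0 < \<kappa>"
  shows "(\<integral>\<^sup>+u. ennreal (spikes (1 + \<kappa>) N M u) \<partial>lborel) \<le> ennreal (real (M + 1) * (2 * real N powr \<kappa> / \<kappa>))"
proof -
  have "(\<integral>\<^sup>+u. ennreal (spikes (1 + \<kappa>) N M u) \<partial>lborel)
      = (\<integral>\<^sup>+u. (\<Sum>m\<le>M. ennreal ((1 / real N + \<bar>u - real m / real M\<bar>) powr (- (1 + \<kappa>)))) \<partial>lborel)"
    by (simp add: spikes_def)
  also have "\<dots> = (\<Sum>m\<le>M. (\<integral>\<^sup>+u. ennreal ((1 / real N + \<bar>u - real m / real M\<bar>) powr (- (1 + \<kappa>))) \<partial>lborel))"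
    by (rule nn_integral_sum) measurable
  also have "\<dots> \<le> (\<Sum>m\<le>M. ennreal (2 * (1 / real N) powr (- \<kappa>) / \<kappa>))"
    using assms by (intro sum_mono nn_integral_shifted_powr_le) auto
  also have "(1 / real N) powr (- \<kappa>) = real N powr \<kappa>"
    using assms by (simp add: powr_minus powr_divide)
  finally show ?thesis
    by (simp add: ennreal_of_nat_eq_real_of_nat ennreal_mult'[symmetric] del: of_nat_Suc)
qed

lemma nn_integral_prod_cart:
  fixes f :: "real \<Rightarrow> real"
  assumes [measurable]: "f \<in> borel_measurable borel" and "\<And>u. 0 \<le> f u"
  shows "(\<integral>\<^sup>+x. ennreal (\<Prod>j\<in>UNIV. f (x $ j)) \<partial>(lborel :: (real ^ 'd) measure)) = (\<integral>\<^sup>+u. ennreal (f u) \<partial>lborel) ^ CARD('d)"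
proof -
  have B: "(Basis :: (real ^ 'd) set) = (\<lambda>j. axis j 1) ` UNIV"
    by (auto simp: Basis_vec_def)
  have inj: "inj (\<lambda>j::'d. axis j (1::real))"
    by (auto simp: inj_on_def axis_eq_axis)
  have "ennreal (\<Prod>j\<in>UNIV. f (x $ j)) = (\<Prod>b\<in>Basis. ennreal (f (x \<bullet> b)))" for x :: "real ^ 'd"
    unfolding B by (subst prod.reindex[OF inj]) (simp add: prod_ennreal[symmetric] assms(2) inner_axis)
  then have "(\<integral>\<^sup>+x. ennreal (\<Prod>j\<in>UNIV. f (x $ j)) \<partial>(lborel :: (real ^ 'd) measure))
      = (\<Prod>b\<in>(Basis :: (real ^ 'd) set). (\<integral>\<^sup>+u. ennreal (f u) \<partial>lborel))"
    by (simp only:) (rule nn_integral_lborel_prod, auto)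
  then show ?thesis by simp
qed


section \<open>Bounds for the maximal function at the critical exponent\<close>

lemma weyl_product_eq:
  "weyl_product r N t x = (\<Prod>j\<in>UNIV. \<Sum>n=1..N. ec (real n * (x $ j - r $ j * t) + (real n)\<^sup>2 * t))"
  unfolding weyl_product_def ec_def cis_conv_exp
  by (intro prod.cong sum.cong refl arg_cong[of _ _ exp]) (simp add: mult_ac)

text \<open>The power 2 \<theta> is the critical exponent: squared bounds are raised to \<theta>,
  and d \<theta> = d + 1 turns the total amplitude into an integer power. All terms are nonnegative,
  so the term of the denominator belonging to \<open>t\<close> lies below the full sum, in which
  \<open>t\<close> no longer occurs.\<close>

lemma weyl_maximal_powr_le:
  fixes r x :: "real ^ 'd"
  defines "d \<equiv> CARD('d)"
  defines "\<theta> \<equiv> 1 + 1 / real d"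
  assumes N: "1 \<le> N" and R: "0 < R" "\<And>j. \<exists>k::int. real R * r $ j = of_int k"
    and x: "\<And>j. 0 \<le> x $ j \<and> x $ j < 1"
  shows "weyl_maximal r N x powr (2 * \<theta>)
      \<le> (\<Sum>q=1..16*N. (10 ^ 10 * (1 + norm r) * (1 + ln (real N))\<^sup>2 * real N / real q) ^ (d + 1)
            * (\<Prod>j\<in>UNIV. spikes \<theta> N (R * q) (x $ j)))"
    (is "_ \<le> ?\<Phi>")
proof -
  define A where "A q = 10 ^ 10 * (1 + norm r) * (1 + ln (real N))\<^sup>2 * real N / real q" for q :: nat
  have d: "0 < real d" by (simp add: d_def)
  have \<theta>: "0 < \<theta>" using d by (simp add: \<theta>_def add_pos_pos)
  have N0: "0 < real N" using N by simp
  have A0: "0 < A q" if "0 < q" for q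
    unfolding A_def using that N by (intro divide_pos_pos mult_pos_pos zero_less_power add_pos_nonneg) auto
  have term_nonneg: "0 \<le> A q ^ (d + 1) * (\<Prod>j\<in>UNIV. spikes \<theta> N (R * q) (x $ j))" if "0 < q" for q
    using A0[OF that] by (intro mult_nonneg_nonneg prod_nonneg zero_le_power) (auto simp: spikes_nonneg)
  have main: "norm (weyl_product r N t x) powr (2 * \<theta>) \<le> ?\<Phi>" for t
  proof -
    define S where "S j = (\<Sum>n=1..N. ec (real n * (x $ j - r $ j * t) + (real n)\<^sup>2 * t))" for j
    from weyl_sum_near_fraction[OF N R(1), of t] obtain q where q: "0 < q" "q \<le> 16 * N"
      and *: "\<And>j. \<exists>m\<le>R * q. (norm (S j))\<^sup>2 \<le> 10 ^ 10 * (1 + \<bar>r $ j\<bar>) * (1 + ln (real N))\<^sup>2 * real N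
          / (real q * (1 / real N + \<bar>x $ j - real m / real (R * q)\<bar>))"
      unfolding S_def using R(2) x by meson
    have factor: "norm (S j) powr (2 * \<theta>) \<le> A q powr \<theta> * spikes \<theta> N (R * q) (x $ j)" for j
    proof -
      from * obtain m where m: "m \<le> R * q"
        and S: "(norm (S j))\<^sup>2 \<le> 10 ^ 10 * (1 + \<bar>r $ j\<bar>) * (1 + ln (real N))\<^sup>2 * real N
          / (real q * (1 / real N + \<bar>x $ j - real m / real (R * q)\<bar>))" by blast
      define D where "D = 1 / real N + \<bar>x $ j - real m / real (R * q)\<bar>"
      have D: "0 < D" unfolding D_def using N0 by (intro add_pos_nonneg) auto
      have "(norm (S j))\<^sup>2 \<le> 10 ^ 10 * (1 + \<bar>r $ j\<bar>) * (1 + ln (real N))\<^sup>2 * real N / (real q * D)"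
        using S by (simp only: D_def)
      also have "\<dots> \<le> 10 ^ 10 * (1 + norm r) * (1 + ln (real N))\<^sup>2 * real N / (real q * D)"
        using D by (intro divide_right_mono mult_right_mono mult_left_mono add_left_mono component_le_norm_cart) auto
      also have "\<dots> = A q / D" by (simp add: A_def)
      finally have "(norm (S j))\<^sup>2 powr \<theta> \<le> (A q / D) powr \<theta>"
        using \<theta> by (intro powr_mono2) auto
      also have "(A q / D) powr \<theta> = A q powr \<theta> * D powr (- \<theta>)"
        using A0[OF q(1)] D by (simp add: powr_divide powr_minus_divide)
      also have "\<dots> \<le> A q powr \<theta> * spikes \<theta> N (R * q) (x $ j)"
        unfolding spikes_def D_def using m
        by (intro mult_left_mono member_le_sum[of m "{..R * q}" "\<lambda>m. (1 / real N + \<bar>x $ j - real m / real (R * q)\<bar>) powr (- \<theta>)"]) auto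
      also have "(norm (S j))\<^sup>2 powr \<theta> = norm (S j) powr (2 * \<theta>)"
        by (simp add: powr_powr[symmetric])
      finally show ?thesis .
    qed
    have "norm (weyl_product r N t x) powr (2 * \<theta>) = (\<Prod>j\<in>UNIV. norm (S j) powr (2 * \<theta>))"
      by (simp add: weyl_product_eq S_def prod_norm[symmetric] prod_powr_distrib)
    also have "\<dots> \<le> (\<Prod>j\<in>UNIV. A q powr \<theta> * spikes \<theta> N (R * q) (x $ j))"
      by (intro prod_mono conjI factor) auto
    also have "\<dots> = (A q powr \<theta>) ^ d * (\<Prod>j\<in>UNIV. spikes \<theta> N (R * q) (x $ j))"
      by (simp add: prod.distrib d_def)
    also have "(A q powr \<theta>) ^ d = A q powr (\<theta> * real d)"
      using A0[OF q(1)] by (simp add: powr_realpow[symmetric] powr_powr)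
    also have "\<theta> * real d = real (d + 1)" using d by (simp add: \<theta>_def field_simps)
    also have "A q powr real (d + 1) = A q ^ (d + 1)"
      using A0[OF q(1)] by (rule powr_realpow)
    also have "A q ^ (d + 1) * (\<Prod>j\<in>UNIV. spikes \<theta> N (R * q) (x $ j))
        \<le> (\<Sum>q=1..16*N. A q ^ (d + 1) * (\<Prod>j\<in>UNIV. spikes \<theta> N (R * q) (x $ j)))"
      using q by (intro member_le_sum[of q "{1..16*N}" "\<lambda>q. A q ^ (d + 1) * (\<Prod>j\<in>UNIV. spikes \<theta> N (R * q) (x $ j))"] term_nonneg) auto
    finally show ?thesis by (simp only: A_def)
  qed
  have "0 \<le> ?\<Phi>"
    using term_nonneg unfolding A_def by (intro sum_nonneg) auto
  \<comment> \<open>The supremum is taken over the norms themselves, so the estimate is pulled back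
    through the power 1/(2 \<theta>) and raised again afterwards.\<close>
  have "weyl_maximal r N x \<le> ?\<Phi> powr (1 / (2 * \<theta>))"
    unfolding weyl_maximal_def
  proof (rule cSUP_least)
    fix t
    have "norm (weyl_product r N t x) = (norm (weyl_product r N t x) powr (2 * \<theta>)) powr (1 / (2 * \<theta>))"
      using \<theta> by (simp add: powr_powr)
    also have "\<dots> \<le> ?\<Phi> powr (1 / (2 * \<theta>))"
      using \<theta> by (intro powr_mono2 main) auto
    finally show "norm (weyl_product r N t x) \<le> ?\<Phi> powr (1 / (2 * \<theta>))" .
  qed simp
  then have "weyl_maximal r N x powr (2 * \<theta>) \<le> (?\<Phi> powr (1 / (2 * \<theta>))) powr (2 * \<theta>)"
    using \<theta> by (intro powr_mono2) (auto simp: weyl_maximal_bounds)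
  also have "\<dots> = ?\<Phi>"
    unfolding powr_powr using \<theta> \<open>0 \<le> ?\<Phi>\<close> by simp
  finally show ?thesis .
qed

lemma fundamental_domain_measurable:
  "{x :: real ^ 'd. \<forall>j. 0 \<le> x $ j \<and> x $ j < 1} \<in> sets borel" (is "?Q \<in> _")
  "{x :: real ^ 'd. \<forall>j. 0 \<le> x $ j \<and> x $ j < 1} \<in> lmeasurable"
proof -
  have Q: "?Q = (\<Inter>j. {x. 0 \<le> x $ j} \<inter> {x. x $ j < 1})" by auto
  show "?Q \<in> sets borel"
    unfolding Q
    by (intro sets.countable_INT'' sets.Int borel_closed borel_open closed_Collect_le
          open_Collect_less continuous_intros) auto
  moreover have "bounded ?Q"
    by (rule bounded_subset[OF bounded_cbox[of 0 1]]) (auto simp: mem_box_cart less_imp_le)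
  ultimately show "?Q \<in> lmeasurable"
    by (intro bounded_set_imp_lmeasurable) auto
qed

text \<open>Enlarging the cube to the whole space moves the integral to \<open>lborel\<close>, where
  products over the coordinates factor.\<close>

lemma nn_integral_torus_measure_le:
  fixes f g :: "real ^ 'd \<Rightarrow> ennreal"
  assumes "\<And>x. (\<And>j. 0 \<le> x $ j \<and> x $ j < 1) \<Longrightarrow> f x \<le> g x"
  shows "(\<integral>\<^sup>+x. f x \<partial>torus_measure) \<le> (\<integral>\<^sup>+x. g x \<partial>lborel)"
proof -
  let ?Q = "{x :: real ^ 'd. \<forall>j. 0 \<le> x $ j \<and> x $ j < 1}"
  have "(\<integral>\<^sup>+x. f x \<partial>torus_measure) = (\<integral>\<^sup>+x. f x * indicator ?Q x \<partial>lebesgue)"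
    unfolding torus_measure_def
    using fmeasurableD[OF fundamental_domain_measurable(2)] by (intro nn_integral_restrict_space) auto
  also have "\<dots> \<le> (\<integral>\<^sup>+x. g x \<partial>lebesgue)"
    using assms by (intro nn_integral_mono) (auto simp: indicator_def)
  finally show ?thesis by (simp add: nn_integral_completion)
qed

lemma finite_measure_torus_measure: "finite_measure (torus_measure :: (real ^ 'd) measure)"
  unfolding torus_measure_def using fundamental_domain_measurable(2) by (rule finite_measure_lebesgue_on)

text \<open>Power count for one q: (N/q)^(d+1) from the amplitudes times (R q N^(1/d))^d from the
  spikes is N^(d+2)/q up to constants. The logarithm occurs 2(d+1) times in the amplitudes and once
  more in the harmonic sum, together 2d + 3.\<close>

lemma nn_integral_weyl_maximal_le:
  fixes r :: "real ^ 'd"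
  defines "d \<equiv> CARD('d)"
  assumes N: "1 \<le> N" and R: "0 < R" "\<And>j. \<exists>k::int. real R * r $ j = of_int k"
  shows "(\<integral>\<^sup>+x. ennreal (weyl_maximal r N x powr (2 * (1 + 1 / real d))) \<partial>torus_measure)
      \<le> ennreal (4 * (10 ^ 10 * (1 + norm r)) ^ (d + 1) * (4 * real d * real R) ^ d
                 * real N ^ (d + 2) * (1 + ln (real N)) ^ (2 * d + 3))"
proof -
  define \<kappa> where "\<kappa> = 1 / real d"
  define L where "L = 1 + ln (real N)"
  define B where "B = 10 ^ 10 * (1 + norm r) * L\<^sup>2"
  have d: "0 < real d" by (simp add: d_def)
  then have \<kappa>: "0 < \<kappa>" by (simp add: \<kappa>_def)
  have N0: "0 < real N" using N by simp
  have L: "1 \<le> L" using N by (simp add: L_def)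
  have B: "0 \<le> B" using L by (simp add: B_def)
  have each: "(\<integral>\<^sup>+x. ennreal ((B * real N / real q) ^ (d + 1) * (\<Prod>j\<in>UNIV. spikes (1 + \<kappa>) N (R * q) (x $ j))) \<partial>(lborel :: (real ^ 'd) measure))
      \<le> ennreal (B ^ (d + 1) * (4 * real d * real R) ^ d * real N ^ (d + 2) * (1 / real q))" if q: "1 \<le> q" for q
  proof -
    define A where "A = (B * real N / real q) ^ (d + 1)"
    define I where "I = real (R * q + 1) * (2 * real N powr \<kappa> / \<kappa>)"
    have A: "0 \<le> A" unfolding A_def using B by (intro zero_le_power divide_nonneg_nonneg mult_nonneg_nonneg) auto
    have I0: "0 \<le> I" unfolding I_def using \<kappa> by (intro mult_nonneg_nonneg divide_nonneg_nonneg) auto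
    have "(\<integral>\<^sup>+x. ennreal (A * (\<Prod>j\<in>UNIV. spikes (1 + \<kappa>) N (R * q) (x $ j))) \<partial>(lborel :: (real ^ 'd) measure))
        = ennreal A * (\<integral>\<^sup>+x. ennreal (\<Prod>j\<in>UNIV. spikes (1 + \<kappa>) N (R * q) (x $ j)) \<partial>(lborel :: (real ^ 'd) measure))"
      using A by (subst nn_integral_cmult[symmetric]) (auto simp: ennreal_mult' intro!: nn_integral_cong)
    also have "\<dots> = ennreal A * (\<integral>\<^sup>+u. ennreal (spikes (1 + \<kappa>) N (R * q) u) \<partial>lborel) ^ d"
      unfolding d_def by (subst nn_integral_prod_cart) (auto simp: spikes_nonneg)
    also have "\<dots> \<le> ennreal A * ennreal I ^ d"
      unfolding I_def by (intro mult_left_mono power_mono nn_integral_spikes_le N \<kappa>) auto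
    also have "\<dots> = ennreal (A * I ^ d)"
      using A I0 by (simp add: ennreal_power ennreal_mult)
    also have "A * I ^ d \<le> A * ((4 * real d * real R * real q) * real N powr \<kappa>) ^ d"
    proof (intro mult_left_mono power_mono A I0)
      have "1 \<le> R * q" using R(1) q by simp
      then have "real (R * q + 1) \<le> 2 * (real R * real q)"
        by (simp only: of_nat_add of_nat_1 of_nat_mult[symmetric])
      then have "I \<le> (2 * (real R * real q)) * (2 * real N powr \<kappa> / \<kappa>)"
        unfolding I_def using \<kappa> by (intro mult_right_mono divide_nonneg_nonneg) auto
      then show "I \<le> (4 * real d * real R * real q) * real N powr \<kappa>"
        by (simp add: \<kappa>_def mult_ac)
    qed
    also have "\<dots> = A * ((4 * real d * real R) ^ d * real q ^ d * (real N powr \<kappa>) ^ d)"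
      by (simp only: power_mult_distrib)
    also have "(real N powr \<kappa>) ^ d = real N"
      using N0 d by (simp add: powr_power \<kappa>_def)
    also have "A * ((4 * real d * real R) ^ d * real q ^ d * real N)
        = B ^ (d + 1) * (4 * real d * real R) ^ d * real N ^ (d + 2) * (1 / real q)"
      using q by (simp add: A_def power_divide power_mult_distrib field_simps)
    finally show ?thesis by (simp only: A_def ennreal_leI)
  qed
  have harm: "(\<Sum>q=1..16*N. 1 / real q) \<le> 4 * L"
  proof -
    have "(\<Sum>q=1..16*N. 1 / real q) = harm (16 * N)" by (simp add: harm_def inverse_eq_divide)
    also have "\<dots> \<le> 1 + ln (real (16 * N))" using N by (intro harm_le_1_plus_ln) auto
    also have "\<dots> \<le> 4 * L" unfolding L_def using N by (intro one_plus_ln_le) auto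
    finally show ?thesis .
  qed
  have "(\<integral>\<^sup>+x. ennreal (weyl_maximal r N x powr (2 * (1 + 1 / real d))) \<partial>torus_measure)
      \<le> (\<integral>\<^sup>+x. ennreal (\<Sum>q=1..16*N. (B * real N / real q) ^ (d + 1) * (\<Prod>j\<in>UNIV. spikes (1 + \<kappa>) N (R * q) (x $ j))) \<partial>(lborel :: (real ^ 'd) measure))"
    unfolding d_def \<kappa>_def B_def L_def
    by (intro nn_integral_torus_measure_le ennreal_leI weyl_maximal_powr_le N R) auto
  also have "\<dots> = (\<integral>\<^sup>+x. (\<Sum>q=1..16*N. ennreal ((B * real N / real q) ^ (d + 1) * (\<Prod>j\<in>UNIV. spikes (1 + \<kappa>) N (R * q) (x $ j)))) \<partial>(lborel :: (real ^ 'd) measure))"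
  proof (intro nn_integral_cong sum_ennreal[symmetric])
    fix q and x :: "real ^ 'd"
    show "0 \<le> (B * real N / real q) ^ (d + 1) * (\<Prod>j\<in>UNIV. spikes (1 + \<kappa>) N (R * q) (x $ j))"
      using B by (intro mult_nonneg_nonneg prod_nonneg zero_le_power divide_nonneg_nonneg) (auto simp: spikes_nonneg)
  qed
  also have "\<dots> = (\<Sum>q=1..16*N. (\<integral>\<^sup>+x. ennreal ((B * real N / real q) ^ (d + 1) * (\<Prod>j\<in>UNIV. spikes (1 + \<kappa>) N (R * q) (x $ j))) \<partial>(lborel :: (real ^ 'd) measure)))"
    by (rule nn_integral_sum) measurable
  also have "\<dots> \<le> (\<Sum>q=1..16*N. ennreal (B ^ (d + 1) * (4 * real d * real R) ^ d * real N ^ (d + 2) * (1 / real q)))"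
    by (intro sum_mono each) auto
  also have "\<dots> = ennreal (\<Sum>q=1..16*N. B ^ (d + 1) * (4 * real d * real R) ^ d * real N ^ (d + 2) * (1 / real q))"
    using B by (intro sum_ennreal) auto
  also have "(\<Sum>q=1..16*N. B ^ (d + 1) * (4 * real d * real R) ^ d * real N ^ (d + 2) * (1 / real q))
      = B ^ (d + 1) * (4 * real d * real R) ^ d * real N ^ (d + 2) * (\<Sum>q=1..16*N. 1 / real q)"
    by (rule sum_distrib_left[symmetric])
  also have "\<dots> \<le> B ^ (d + 1) * (4 * real d * real R) ^ d * real N ^ (d + 2) * (4 * L)"
    using B by (intro mult_left_mono harm mult_nonneg_nonneg) auto
  also have "\<dots> = 4 * (10 ^ 10 * (1 + norm r)) ^ (d + 1) * (4 * real d * real R) ^ d * real N ^ (d + 2) * L ^ (2 * d + 3)"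
  proof -
    have "B ^ (d + 1) * L = (10 ^ 10 * (1 + norm r)) ^ (d + 1) * ((L\<^sup>2) ^ (d + 1) * L)"
      unfolding B_def power_mult_distrib[of _ "L\<^sup>2"] by (simp only: mult.assoc)
    also have "(L\<^sup>2) ^ (d + 1) * L = L ^ (2 * (d + 1) + 1)"
      by (simp only: power_mult power_add power_one_right)
    also have "2 * (d + 1) + 1 = 2 * d + 3" by simp
    finally have BL: "B ^ (d + 1) * L = (10 ^ 10 * (1 + norm r)) ^ (d + 1) * L ^ (2 * d + 3)" .
    have "B ^ (d + 1) * (4 * real d * real R) ^ d * real N ^ (d + 2) * (4 * L)
        = 4 * (B ^ (d + 1) * L) * (4 * real d * real R) ^ d * real N ^ (d + 2)"
      by (simp only: mult_ac)
    then show ?thesis unfolding BL by (simp only: mult_ac)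
  qed
  finally show ?thesis by (simp add: ennreal_leI L_def)
qed


section \<open>Absorption of the logarithms and passage to all exponents\<close>

lemma one_plus_ln_power_le:
  assumes "0 < \<epsilon>"
  shows "\<exists>C\<ge>0. \<forall>x\<ge>1. (1 + ln x) ^ k \<le> C * x powr (\<epsilon> :: real)"
\<comment> \<open>Each of the k factors receives the exponent \<epsilon>/k; for k = 0 this quotient
  would be 0, hence the separate case.\<close>
proof (cases "k = 0")
  case True
  then show ?thesis using assms by (intro exI[of _ 1]) (simp add: ge_one_powr_ge_zero)
next
  case False
  define a where "a = \<epsilon> / real k"
  have a: "0 < a" using False assms by (simp add: a_def)
  have "(1 + ln x) ^ k \<le> (1 + 1 / a) ^ k * x powr \<epsilon>" if "1 \<le> x" for x :: real
  proof -
    have "1 + ln x \<le> x powr a + x powr a / a"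
      using that a by (intro add_mono ge_one_powr_ge_zero ln_powr_bound) auto
    also have "\<dots> = (1 + 1 / a) * x powr a" by (simp add: algebra_simps)
    finally have "(1 + ln x) ^ k \<le> ((1 + 1 / a) * x powr a) ^ k"
      using that by (intro power_mono) auto
    also have "\<dots> = (1 + 1 / a) ^ k * x powr \<epsilon>"
      using that False by (simp add: power_mult_distrib powr_power a_def)
    finally show ?thesis .
  qed
  then show ?thesis using a by (intro exI[of _ "(1 + 1 / a) ^ k"]) auto
qed

lemma common_denominator:
  fixes r :: "'a :: finite \<Rightarrow> real"
  assumes "\<And>j. r j \<in> \<rat>"
  shows "\<exists>R>0. \<forall>j. \<exists>k::int. real R * r j = of_int k"
proof -
  have "\<exists>b>0. \<exists>a::int. r j = of_int a / of_int b" for j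
    using assms[of j] by (auto elim!: Rats_cases')
  then obtain b a where b: "\<And>j. 0 < (b j :: int)" and a: "\<And>j. r j = of_int (a j) / of_int (b j)"
    by metis
  define R where "R = nat (\<Prod>j\<in>UNIV. b j)"
  have pos: "0 < (\<Prod>j\<in>UNIV. b j)" using b by (simp add: prod_pos)
  have "\<exists>k::int. real R * r j = of_int k" for j
  proof -
    have "real R = real_of_int (b j * (\<Prod>i\<in>UNIV-{j}. b i))"
      using pos by (simp add: R_def prod.remove[of UNIV j] del: of_int_mult of_int_prod)
    then have "real R * r j = of_int ((\<Prod>i\<in>UNIV-{j}. b i) * a j)"
      using b[of j] by (simp add: a)
    then show ?thesis by blast
  qed
  then show ?thesis using pos by (intro exI[of _ R]) (auto simp: R_def)
qed

text \<open>The loss \<open>\<epsilon>\<close> stays a parameter because each range of p supplies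
  its own slack. Integrability transfers the bound from the nonnegative integral to the Bochner
  integral.\<close>

lemma integral_weyl_maximal_critical_le:
  fixes r :: "real ^ 'd" and \<epsilon> :: real
  defines "d \<equiv> real CARD('d)"
  assumes "\<And>j. r $ j \<in> \<rat>" and \<epsilon>: "0 < \<epsilon>"
  shows "\<exists>C\<ge>0. \<forall>N\<ge>1. (LINT x|torus_measure. weyl_maximal r N x powr (2 * (d + 1) / d)) \<le> C * real N powr (d + 2 + \<epsilon>)"
proof -
  obtain R where R: "0 < R" "\<And>j. \<exists>k::int. real R * r $ j = of_int k"
    using common_denominator[of "\<lambda>j. r $ j"] assms(2) by blast
  obtain C where C: "0 \<le> C" "\<And>x::real. 1 \<le> x \<Longrightarrow> (1 + ln x) ^ (2 * CARD('d) + 3) \<le> C * x powr \<epsilon>"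
    using one_plus_ln_power_le[OF \<epsilon>] by blast
  define K where "K = 4 * (10 ^ 10 * (1 + norm r)) ^ (CARD('d) + 1) * (4 * d * real R) ^ CARD('d)"
  have d: "0 < d" by (simp add: d_def)
  have K: "0 \<le> K" unfolding K_def using d by (intro mult_nonneg_nonneg zero_le_power add_nonneg_nonneg) auto
  have p: "2 * (d + 1) / d = 2 * (1 + 1 / d)" using d by (simp add: field_simps)
  have "(LINT x|torus_measure. weyl_maximal r N x powr (2 * (d + 1) / d)) \<le> K * C * real N powr (d + 2 + \<epsilon>)"
    if N: "1 \<le> N" for N
  proof -
    have N0: "1 \<le> real N" using N by simp
    define I where "I = (LINT x|torus_measure. weyl_maximal r N x powr (2 * (d + 1) / d))"
    have "integrable torus_measure (\<lambda>x. weyl_maximal r N x powr (2 * (d + 1) / d))"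
      using integrable_weyl_maximal[of "2 * (d + 1) / d" r N] d by (simp add: weyl_maximal_bounds)
    then have "ennreal I = (\<integral>\<^sup>+x. ennreal (weyl_maximal r N x powr (2 * (d + 1) / d)) \<partial>torus_measure)"
      unfolding I_def by (intro nn_integral_eq_integral[symmetric]) auto
    also have "\<dots> \<le> ennreal (K * real N ^ (CARD('d) + 2) * (1 + ln (real N)) ^ (2 * CARD('d) + 3))"
      unfolding p unfolding K_def d_def by (rule nn_integral_weyl_maximal_le[OF N R])
    finally have "I \<le> K * real N ^ (CARD('d) + 2) * (1 + ln (real N)) ^ (2 * CARD('d) + 3)"
      using K N0 by (subst (asm) ennreal_le_iff) auto
    also have "\<dots> \<le> K * real N ^ (CARD('d) + 2) * (C * real N powr \<epsilon>)"
      using K N0 by (intro mult_left_mono C(2)) auto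
    also have "real N ^ (CARD('d) + 2) = real N powr (d + 2)"
      using N0 by (subst powr_realpow[symmetric]) (auto simp: d_def add.commute)
    also have "K * real N powr (d + 2) * (C * real N powr \<epsilon>) = K * C * real N powr (d + 2 + \<epsilon>)"
      by (simp add: powr_add)
    finally show ?thesis by (simp only: I_def)
  qed
  then show ?thesis using K C(1) by (intro exI[of _ "K * C"]) auto
qed

theorem theorem1p3:
  fixes p s :: real and r :: "real ^ 'd"
  assumes "CARD('d) \<ge> 2"
    and "1 \<le> p"
    and "\<And>j. r $ j \<in> \<rat>"
    and "p \<le> 2 * (real CARD('d) + 1) / real CARD('d) \<Longrightarrow>
           s > real CARD('d) / (2 * (real CARD('d) + 1))"
    and "p \<ge> 2 * (real CARD('d) + 1) / real CARD('d) \<Longrightarrow>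
           s > real CARD('d) / 2 - real CARD('d) / p"
  shows "\<exists>C::real. \<forall>N::nat. N \<ge> 1 \<longrightarrow>
           Lp_norm p torus_measure (weyl_maximal r N)
             \<le> C * real N powr (real CARD('d) / 2 + s)"
proof -
  define d where "d = real CARD('d)"
  define c where "c = 2 * (d + 1) / d"
  define \<sigma> where "\<sigma> = d / 2 + s"
  have d: "0 < d" by (simp add: d_def)
  have c: "0 < c" using d by (simp add: c_def)
  have dc: "d * c = 2 * d + 2" using d by (simp add: c_def)
  have p: "0 < p" using assms(2) by simp
  note nonneg = weyl_maximal_bounds(1)
  have int: "integrable torus_measure (\<lambda>x. weyl_maximal r N x powr e)" if "0 < e" for N e
    using integrable_weyl_maximal[OF that, of r N] by (simp add: nonneg)
  have "\<exists>C\<ge>0. \<forall>N\<ge>1. (LINT x|torus_measure. weyl_maximal r N x powr p) \<le> C * (real N powr \<sigma>) powr p"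
  proof (cases "p \<le> c")
    case True
    have "d / (2 * (d + 1)) < s"
      using assms(4) True by (simp add: c_def d_def)
    then have "d / (2 * (d + 1)) * c < s * c" using c by (rule mult_strict_right_mono)
    moreover have "d / (2 * (d + 1)) * c = 1" "d / 2 * c = d + 1" using d by (simp_all add: c_def)
    moreover have "\<sigma> * c = d / 2 * c + s * c" by (simp only: \<sigma>_def ring_distribs)
    \<comment> \<open>The strict lower bound on s amounts to s c > 1, and d c/2 = d + 1. Using this
      slack as \<epsilon> makes the critical bound exactly a multiple of N^(\<sigma> c).\<close>
    ultimately have "0 < \<sigma> * c - (d + 2)" by linarith
    from integral_weyl_maximal_critical_le[OF assms(3) this] obtain C where C: "0 \<le> C"
      "\<And>N. 1 \<le> N \<Longrightarrow> (LINT x|torus_measure. weyl_maximal r N x powr c) \<le> C * real N powr (\<sigma> * c)"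
      by (auto simp: c_def d_def)
    define V where "V = measure (torus_measure :: (real ^ 'd) measure) (space torus_measure)"
    interpret finite_measure "torus_measure :: (real ^ 'd) measure"
      by (rule finite_measure_torus_measure)
    have "(LINT x|torus_measure. weyl_maximal r N x powr p) \<le> (V + C) * (real N powr \<sigma>) powr p" if N: "1 \<le> N" for N
    proof -
      define \<mu> where "\<mu> = real N powr \<sigma>"
      have \<mu>: "0 < \<mu>" using N by (simp add: \<mu>_def)
      \<comment> \<open>The cut-off height is the target size \<mu> = N^\<sigma> itself. Both parts
        then integrate to O(\<mu>^p), as the c-th power of the maximal function integrates to at
        most C \<mu>^c.\<close>
      have pw: "u powr p \<le> \<mu> powr p + \<mu> powr (p - c) * u powr c" if "0 \<le> u" for u
      proof (cases "u \<le> \<mu>")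
        case True
        then have "u powr p \<le> \<mu> powr p" using that p by (intro powr_mono2) auto
        then show ?thesis by (simp add: add_increasing2)
      next
        case False
        then have "u powr p = u powr (p - c) * u powr c" using \<mu> by (simp add: powr_add[symmetric])
        also have "\<dots> \<le> \<mu> powr (p - c) * u powr c"
          using False \<mu> \<open>p \<le> c\<close> by (intro mult_right_mono powr_mono2') auto
        finally show ?thesis by (simp add: add_increasing)
      qed
      have "(LINT x|torus_measure. weyl_maximal r N x powr p)
          \<le> (LINT x|torus_measure. \<mu> powr p + \<mu> powr (p - c) * weyl_maximal r N x powr c)"
        by (intro integral_mono int p Bochner_Integration.integrable_add integrable_mult_right c pw nonneg) auto
      also have "\<dots> = \<mu> powr p * V + \<mu> powr (p - c) * (LINT x|torus_measure. weyl_maximal r N x powr c)"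
        using int[OF c, of N] by (simp add: V_def)
      also have "\<dots> \<le> \<mu> powr p * V + \<mu> powr (p - c) * (C * real N powr (\<sigma> * c))"
        by (intro add_left_mono mult_left_mono C(2) N) auto
      also have "real N powr (\<sigma> * c) = \<mu> powr c" by (simp add: \<mu>_def powr_powr)
      also have "\<mu> powr p * V + \<mu> powr (p - c) * (C * \<mu> powr c) = (V + C) * \<mu> powr p"
        using \<mu> by (simp add: powr_diff algebra_simps)
      finally show ?thesis by (simp only: \<mu>_def)
    qed
    then show ?thesis using C(1) by (intro exI[of _ "V + C"]) (auto simp: V_def)
  next
    case False
    have "d / 2 - d / p < s"
      using assms(5) False by (simp add: c_def d_def)
    then have "(d / 2 - d / p) * p < s * p" using p by (rule mult_strict_right_mono)
    \<comment> \<open>This slack becomes \<epsilon>. It is arranged so that adding d (p - c), the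
      cost of the trivial bound, gives exactly \<sigma> p in view of d c = 2 d + 2.\<close>
    then have "0 < \<sigma> * p - (d * p - d)" using p by (simp add: \<sigma>_def algebra_simps)
    from integral_weyl_maximal_critical_le[OF assms(3) this] obtain C where C: "0 \<le> C"
      "\<And>N. 1 \<le> N \<Longrightarrow> (LINT x|torus_measure. weyl_maximal r N x powr c) \<le> C * real N powr (d + 2 + (\<sigma> * p - (d * p - d)))"
      by (auto simp: c_def d_def)
    have "(LINT x|torus_measure. weyl_maximal r N x powr p) \<le> C * (real N powr \<sigma>) powr p" if N: "1 \<le> N" for N
    proof -
      define \<Lambda> where "\<Lambda> = real N powr d"
      have \<Lambda>: "real N ^ CARD('d) = \<Lambda>" using N by (simp add: \<Lambda>_def d_def powr_realpow)
      \<comment> \<open>The surplus power p - c is paid for with the trivial bound N^d.\<close>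
      have pw: "weyl_maximal r N x powr p \<le> \<Lambda> powr (p - c) * weyl_maximal r N x powr c" for x
      proof -
        have "weyl_maximal r N x powr p = weyl_maximal r N x powr (p - c) * weyl_maximal r N x powr c"
          by (simp add: powr_add[symmetric])
        also have "\<dots> \<le> \<Lambda> powr (p - c) * weyl_maximal r N x powr c"
          using False weyl_maximal_bounds[of r N x] by (intro mult_right_mono powr_mono2) (auto simp: \<Lambda>)
        finally show ?thesis .
      qed
      have "(LINT x|torus_measure. weyl_maximal r N x powr p)
          \<le> (LINT x|torus_measure. \<Lambda> powr (p - c) * weyl_maximal r N x powr c)"
        by (intro integral_mono int p integrable_mult_right c pw)
      also have "\<dots> = \<Lambda> powr (p - c) * (LINT x|torus_measure. weyl_maximal r N x powr c)"
        by simp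
      also have "\<dots> \<le> \<Lambda> powr (p - c) * (C * real N powr (d + 2 + (\<sigma> * p - (d * p - d))))"
        by (intro mult_left_mono C(2) N) auto
      also have "\<dots> = C * real N powr (d * (p - c) + (d + 2 + (\<sigma> * p - (d * p - d))))"
        by (simp add: \<Lambda>_def powr_powr powr_add)
      also have "d * (p - c) + (d + 2 + (\<sigma> * p - (d * p - d))) = \<sigma> * p"
        using dc by (simp add: right_diff_distrib)
      finally show ?thesis by (simp add: powr_powr)
    qed
    then show ?thesis using C(1) by blast
  qed
  then obtain C where C: "0 \<le> C"
    "\<And>N. 1 \<le> N \<Longrightarrow> (LINT x|torus_measure. weyl_maximal r N x powr p) \<le> C * (real N powr \<sigma>) powr p"
    by blast
  have "Lp_norm p torus_measure (weyl_maximal r N) \<le> C powr (1 / p) * real N powr \<sigma>" if N: "1 \<le> N" for N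
  proof -
    have "Lp_norm p torus_measure (weyl_maximal r N) = (LINT x|torus_measure. weyl_maximal r N x powr p) powr (1 / p)"
      by (simp add: Lp_norm_def nonneg)
    also have "\<dots> \<le> (C * (real N powr \<sigma>) powr p) powr (1 / p)"
      using C(2)[OF N] p by (intro powr_mono2) (auto intro!: integral_nonneg_AE)
    also have "\<dots> = C powr (1 / p) * real N powr \<sigma>"
      using C(1) p by (simp add: powr_mult powr_powr)
    finally show ?thesis .
  qed
  then show ?thesis unfolding \<sigma>_def d_def by blast
qed

end
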